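(* For $1 \le p < \infty$ let $\kappa_p$ be the constant defined as follows: $\kappa_1 := 3+\sqrt{5}$ and, for $p>1$, $\kappa_p$ is the largest real root $K \ge 2^{1/p}$ of the equation $$\frac{2^{1/p}}{K} = \left(1-\frac{2}{K^p}\right)^{1/p}\left(1-\frac{1}{K}\right).$$ Then $k_0(l_p) \ge \kappa_p$ for every $1 \le p < \infty$, and $\kappa_p > 3$ for all $1 \le p \le 1.6$. In particular, $k_0(l_1) \ge 3+\sqrt{5}$.
   Context: For $1\le p<\infty$, $l_p$ is the Banach space of real sequences $x=(x_n)_{n\ge1}$ with $\|x\| = (\sum_n |x_n|^p)^{1/p}<\infty$. For a Banach space $X$, $B_X=\{x\in X:\|x\|\le 1\}$ denotes the (closed) unit ball and $S_X=\{x\in X:\|x\|=1\}$ the unit sphere. A retraction $R:B_X\to S_X$ is a map with $R(x)=x$ for all $x\in S_X$; it is $k$-Lipschitz if $\|R(x)-R(y)\|\le k\|x-y\|$ for all $x,y\in B_X$. For an infinite-dimensional Banach space $X$, $$k_0(X) := \inf\{k>0 : \text{there exists a } k\text{-Lipschitz retraction } R:B_X\to S_X\}.$$ *)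

theory Defs
  imports "HOL-Analysis.Analysis" "HOL-Library.Function_Algebras"
begin

text \<open>
  The exponent \<open>p\<close> is a real number quantified inside the statement, so \<open>l\<^sub>p\<close> cannot be a type of
  class \<^class>\<open>banach\<close>. A normed space is given here by a carrier set \<open>V\<close> and a norm \<open>N\<close>.
  Sequences are indexed from \<open>0\<close>.
\<close>

definition lp :: "real \<Rightarrow> (nat \<Rightarrow> real) set" where
  "lp p = {x. summable (\<lambda>n. \<bar>x n\<bar> powr p)}"

definition lp_norm :: "real \<Rightarrow> (nat \<Rightarrow> real) \<Rightarrow> real" where
  "lp_norm p x = (\<Sum>n. \<bar>x n\<bar> powr p) powr (1 / p)"

definition unit_ball :: "'a set \<Rightarrow> ('a \<Rightarrow> real) \<Rightarrow> 'a set" where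
  "unit_ball V N = {x \<in> V. N x \<le> 1}"

definition unit_sphere :: "'a set \<Rightarrow> ('a \<Rightarrow> real) \<Rightarrow> 'a set" where
  "unit_sphere V N = {x \<in> V. N x = 1}"

definition lipschitz_retraction ::
  "'a::ab_group_add set \<Rightarrow> ('a \<Rightarrow> real) \<Rightarrow> real \<Rightarrow> ('a \<Rightarrow> 'a) \<Rightarrow> bool" where
  "lipschitz_retraction V N k R \<longleftrightarrow>
     R \<in> unit_ball V N \<rightarrow> unit_sphere V N \<and>
     (\<forall>x \<in> unit_sphere V N. R x = x) \<and>
     (\<forall>x \<in> unit_ball V N. \<forall>y \<in> unit_ball V N. N (R x - R y) \<le> k * N (x - y))"

text \<open>
  The infimum is taken in \<^typ>\<open>ereal\<close>, where the infimum of the empty set is \<open>\<infinity>\<close>. (In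
  \<^typ>\<open>real\<close> it would be an unspecified number.)
\<close>

definition k0 :: "'a::ab_group_add set \<Rightarrow> ('a \<Rightarrow> real) \<Rightarrow> ereal" where
  "k0 V N = Inf (ereal ` {k. k > 0 \<and> (\<exists>R. lipschitz_retraction V N k R)})"

definition kappa_root :: "real \<Rightarrow> real \<Rightarrow> bool" where
  "kappa_root p K \<longleftrightarrow> K \<ge> 2 powr (1 / p) \<and>
     2 powr (1 / p) / K = (1 - 2 / K powr p) powr (1 / p) * (1 - 1 / K)"

definition kappa :: "real \<Rightarrow> real" where
  "kappa p = (if p = 1 then 3 + sqrt 5 else (GREATEST K. kappa_root p K))"

text \<open>For \<open>p > 1\<close> the largest root exists, so \<^const>\<open>Greatest\<close> is well defined in \<^const>\<open>kappa\<close>.\<close>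

lemma kappa_greatest_root:
  assumes p: "p > 1"
  shows "kappa_root p (kappa p)" and "\<And>K. kappa_root p K \<Longrightarrow> K \<le> kappa p"
proof -
  define a where "a = (2::real) powr (1 / p)"
  define f where "f K = (1 - 2 / K powr p) powr (1 / p) * (1 - 1 / K) - a / K" for K
  have a1: "a > 1" unfolding a_def using p by (simp add: gr_one_powr)
  have a2: "a \<le> 2" unfolding a_def using p powr_mono[of "1/p" 1 "2::real"] by simp
  have ap: "a powr p = 2" unfolding a_def using p by (simp add: powr_powr)
  have base: "0 \<le> 1 - 2 / K powr p" if "K \<ge> a" for K
  proof -
    have "2 \<le> K powr p" using powr_mono2[of p a K] that a1 p ap by simp
    then show ?thesis by (simp add: divide_le_eq)
  qed
  have mono: "f K < f L" if "a \<le> K" "K < L" for K L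
  proof -
    have "K powr p \<le> L powr p" using that a1 p by (intro powr_mono2) auto
    moreover have "K powr p > 0" using that a1 by simp
    ultimately have "1 - 2 / K powr p \<le> 1 - 2 / L powr p" by (simp add: frac_le)
    then have "(1 - 2 / K powr p) powr (1/p) \<le> (1 - 2 / L powr p) powr (1/p)"
      using base[OF that(1)] p by (intro powr_mono2) auto
    moreover have "1 - 1 / K \<le> 1 - 1 / L" "0 \<le> 1 - 1 / K"
      using that a1 by (auto simp: field_simps)
    ultimately have "(1 - 2 / K powr p) powr (1/p) * (1 - 1 / K)
        \<le> (1 - 2 / L powr p) powr (1/p) * (1 - 1 / L)"
      by (intro mult_mono) auto
    moreover have "a / L < a / K" using that a1 by (simp add: frac_less2)
    ultimately show ?thesis unfolding f_def by linarith
  qed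
  have fa: "f a < 0" unfolding f_def using ap a1 by simp
  have f8: "f 8 > 0"
  proof -
    have "(8::real) \<le> 8 powr p" using powr_mono[of 1 p "8::real"] p by simp
    then have b: "3 / 4 \<le> 1 - 2 / (8::real) powr p" by (simp add: field_simps)
    have "1 - 2 / (8::real) powr p \<le> (1 - 2 / 8 powr p) powr (1 / p)"
      using powr_mono'[of "1 / p" 1 "1 - 2 / (8::real) powr p"] b p by simp
    with b have "3 / 4 \<le> (1 - 2 / (8::real) powr p) powr (1 / p)" by (rule order_trans)
    then have "3 / 4 * (7 / 8) \<le> (1 - 2 / (8::real) powr p) powr (1 / p) * (1 - 1 / 8)"
      by (rule mult_mono) simp_all
    then show ?thesis unfolding f_def using a2 by linarith
  qed
  have nz: "K powr p \<noteq> 0" "K \<noteq> 0" if "K \<in> {a..8}" for K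
    using that a1 by auto
  have "continuous_on {a..8} (\<lambda>K. K powr p)"
    by (rule continuous_on_powr) (use nz in \<open>auto intro: continuous_on_id continuous_on_const\<close>)
  then have "continuous_on {a..8} (\<lambda>K. 1 - 2 / K powr p)"
    using nz(1) by (intro continuous_on_diff continuous_on_divide continuous_on_const) blast+
  then have "continuous_on {a..8} (\<lambda>K. (1 - 2 / K powr p) powr (1 / p))"
    by (rule continuous_on_powr') (use base p in auto)
  then have "continuous_on {a..8} f"
    unfolding f_def using nz(2)
    by (intro continuous_on_diff continuous_on_mult continuous_on_divide continuous_on_const
        continuous_on_id) blast+
  then obtain K where K: "a \<le> K" "f K = 0"
    using IVT'[of f a 0 8] fa f8 a2 by auto
  have root: "kappa_root p L \<longleftrightarrow> a \<le> L \<and> f L = 0" for L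
    unfolding kappa_root_def f_def a_def by auto
  have uniq: "L = K" if "kappa_root p L" for L
    using that K mono[of L K] mono[of K L] unfolding root by (cases L K rule: linorder_cases) auto
  have "kappa_root p K" using K root by blast
  moreover have "(GREATEST L. kappa_root p L) = K"
    by (rule Greatest_equality) (fact, rule eq_refl, rule uniq)
  then have "kappa p = K" unfolding kappa_def using p by simp
  ultimately show "kappa_root p (kappa p)" and "\<And>L. kappa_root p L \<Longrightarrow> L \<le> kappa p"
    using uniq by (metis, metis order_refl)
qed

end

theory Submission
  imports Defs "HOL-Homology.Brouwer_Degree" "HOL-Complex_Analysis.Great_Picard"
begin

text \<open>
  Let \<open>R\<close> be a \<open>k\<close>-Lipschitz retraction of the unit ball of \<open>l\<^sub>p\<close> onto its sphere, and let
  \<open>a = 2 powr (1 / p)\<close>, the distance of two unit vectors with disjoint supports. Every \<open>w\<close> in the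
  sphere is fixed by \<open>R\<close>, so \<open>N (w - R x) \<le> k * N (w - x)\<close> for all \<open>x\<close> in the ball. This bounds \<open>k\<close>
  from below as soon as some \<open>x\<close> close to the sphere has an image pointing away from \<open>x\<close>. Such an
  \<open>x\<close> is built in two steps.

  First, \<open>x = - \<sigma> * R x\<close> has a solution for every \<open>\<sigma> < 1 / k\<close>, and in \<open>l\<^sub>1\<close> even for every
  \<open>\<sigma> < 2 / k\<close> (\<open>antipodal_point\<close>). Brouwer's theorem solves the truncated equations. Their images
  converge coordinatewise, and \<open>brezis_lieb\<close> computes how much norm escapes to infinity: when
  \<open>\<sigma>\<close> is that small, an escape would contradict the Lipschitz bound between the approximate
  solutions and their limit. In \<open>l\<^sub>1\<close> the escaping mass is counted twice, whence the factor 2. With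
  \<open>y = R x\<close>, comparing \<open>x = - \<sigma> y\<close> to \<open>w = - y\<close> gives \<open>2 \<le> k * (1 - \<sigma>)\<close>.

  Second, as long as one moves from \<open>- \<sigma> y\<close> by less than \<open>a / k\<close>, the image stays within a distance
  less than \<open>a\<close> of \<open>y\<close>, so it cannot have become disjoint from, or opposite to, \<open>y\<close>: some part of
  the image still agrees with \<open>y\<close> or lies off its support. Brouwer's theorem, applied to the
  normalized negative of that part, makes the displacement point exactly against it. This yields
  \<open>x = - (\<sigma> y + g)\<close> with \<open>N g = s\<close> as close to \<open>a / k\<close> as desired, such that \<open>R x\<close> has the sign of
  \<open>g\<close> on the support of \<open>g\<close> (\<open>aligned_perturbation\<close>). Stretching \<open>g\<close> until the sphere is reached
  gives a \<open>w\<close> close to \<open>x\<close> and far from \<open>R x\<close> (\<open>displacement_estimate\<close>). In the limit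
  \<open>s \<rightarrow> a / k\<close>, with \<open>A = (1 - \<sigma> powr p) powr (1 / p)\<close>,
  \<open>a + a / 2 * (A + (1 - \<sigma>)) \<le> k * A\<close> (\<open>retraction_inequality\<close>).

  Suppose now that \<open>k < \<kappa>\<close>, where \<open>\<kappa> = kappa p\<close>. For \<open>p = 1\<close> the choice \<open>\<sigma> = 2 / \<kappa>\<close> contradicts
  \<open>\<kappa>\<^sup>2 - 6 * \<kappa> + 4 = 0\<close>. For \<open>p > 1\<close> the defining equation of \<open>\<kappa>\<close> says
  \<open>2 / \<kappa> powr p + 2 / (\<kappa> - 1) powr p = 1\<close>, and the choice is \<open>\<sigma> = 1 / \<kappa>\<close>. The first bound gives
  \<open>\<kappa> > 3\<close>, which is incompatible with the equation if \<open>p > 2\<close>. If \<open>p \<le> 2\<close>, the equation turns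
  the second bound into an inequality between \<open>p\<close> and \<open>d = 1 - 1 / \<kappa>\<close> that fails for \<open>d \<ge> 2 / 3\<close>
  (\<open>tangent_gap\<close>). The equation also shows \<open>\<kappa> > 3\<close> for \<open>p \<le> 1.6\<close>, because its left-hand side
  decreases in \<open>\<kappa>\<close> and in \<open>p\<close> and is still greater than 1 at \<open>\<kappa> = 3\<close>, \<open>p = 1.6\<close>.
\<close>

section \<open>Brouwer's fixed point theorem for sequences of finite support\<close>

lemma sphere_not_contractible:
  "\<not> contractible {x::nat \<Rightarrow> real. (\<Sum>i\<le>n. (x i)\<^sup>2) = 1 \<and> (\<forall>i>n. x i = 0)}"
proof -
  have "nsphere n = top_of_set {x. (\<Sum>i\<le>n. (x i)\<^sup>2) = 1 \<and> (\<forall>i>n. x i = 0)}"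
    by (simp add: nsphere euclidean_product_topology)
  then show ?thesis
    using non_contractible_space_nsphere[of n] by simp
qed

text \<open>
  The dimension is a number here, not a type. A map \<open>f\<close> without fixed points would contract the unit
  sphere: \<open>s * x - f (s * x)\<close> never vanishes, it is constant in \<open>x\<close> at \<open>s = 0\<close>, and for \<open>s\<close> beyond
  the bound on \<open>f\<close> the second term can be faded out without creating a zero.
\<close>

lemma brouwer_bounded:
  fixes f :: "(nat \<Rightarrow> real) \<Rightarrow> nat \<Rightarrow> real" and n :: nat
  defines "E \<equiv> {x. \<forall>i>n. x i = 0}"
  assumes cont: "continuous_on E f" and maps: "f \<in> E \<rightarrow> E"
    and bnd: "\<And>x i. x \<in> E \<Longrightarrow> \<bar>f x i\<bar> \<le> M"
  shows "\<exists>x\<in>E. f x = x"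
proof (rule ccontr)
  assume "\<not> ?thesis"
  then have nofix: "f x \<noteq> x" if "x \<in> E" for x using that by blast
  define S where "S = {x::nat \<Rightarrow> real. (\<Sum>i\<le>n. (x i)\<^sup>2) = 1 \<and> (\<forall>i>n. x i = 0)}"
  define L where "L = (real n + 1) * (\<bar>M\<bar> + 1)"
  have L: "L > 0" unfolding L_def by (intro mult_pos_pos) auto
  \<comment> \<open>The weight of \<open>f\<close>: it is 1 while \<open>s \<le> L\<close> and reaches 0 at \<open>s = L + 1\<close>; in between
    \<open>s\<close> exceeds the Euclidean norm \<open>\<le> L\<close> of \<open>f\<close>.\<close>
  define \<phi> where "\<phi> s = min 1 (L + 1 - s)" for s :: real
  define g where "g = (\<lambda>(s::real, x::nat \<Rightarrow> real) i. s * x i - \<phi> s * f (\<lambda>j. s * x j) i)"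
  define q where "q z = sqrt (\<Sum>i\<le>n. (z i)\<^sup>2)" for z :: "nat \<Rightarrow> real"
  have SE: "(\<lambda>j. s * x j) \<in> E" if "x \<in> S" for s x
    using that unfolding S_def E_def by auto
  have gE: "g (s, x) \<in> E" if "x \<in> S" for s x
    using maps SE[OF that, of s] that unfolding g_def S_def E_def by auto
  have g0: "\<exists>i\<le>n. g (s, x) i \<noteq> 0" if s: "0 \<le> s" "s \<le> L + 1" and x: "x \<in> S" for s x
  proof (rule ccontr)
    assume "\<not> ?thesis"
    then have z: "g (s, x) i = 0" for i
      using gE[OF x, of s] unfolding E_def by (metis (mono_tags) mem_Collect_eq not_le)
    have eq: "s * x i = \<phi> s * f (\<lambda>j. s * x j) i" for i
      using z[of i] by (simp add: g_def)
    show False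
    proof (cases "s \<le> L")
      case True
      then have "\<phi> s = 1" unfolding \<phi>_def by simp
      then have "f (\<lambda>j. s * x j) i = s * x i" for i using eq[of i] by simp
      then have "f (\<lambda>j. s * x j) = (\<lambda>j. s * x j)" by (rule ext)
      then show False using nofix[OF SE[OF x]] by blast
    next
      case False
      have ph: "0 \<le> \<phi> s" "\<phi> s \<le> 1" using s unfolding \<phi>_def by auto
      have le: "\<bar>s * x i\<bar> \<le> \<bar>M\<bar>" for i
      proof -
        have "\<bar>s * x i\<bar> = \<phi> s * \<bar>f (\<lambda>j. s * x j) i\<bar>" using eq[of i] ph by (simp add: abs_mult)
        also have "\<dots> \<le> 1 * \<bar>M\<bar>"
          using bnd[OF SE[OF x], of s i] ph by (intro mult_mono) auto
        finally show ?thesis by simp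
      qed
      have "(s * x i)\<^sup>2 \<le> M\<^sup>2" for i using le[of i] by (simp add: abs_le_square_iff)
      then have "(\<Sum>i\<le>n. (s * x i)\<^sup>2) \<le> (\<Sum>i\<le>n. M\<^sup>2)" by (intro sum_mono) auto
      also have "\<dots> = (real n + 1) * M\<^sup>2" by simp
      finally have a: "s\<^sup>2 \<le> (real n + 1) * M\<^sup>2"
        using x unfolding S_def by (simp add: power_mult_distrib flip: sum_distrib_left)
      have "L\<^sup>2 < s\<^sup>2" using False L by (intro power_strict_mono) auto
      moreover have "(real n + 1) * M\<^sup>2 \<le> L\<^sup>2"
      proof -
        have "M\<^sup>2 \<le> (\<bar>M\<bar> + 1)\<^sup>2" by (intro power2_le_iff_abs_le[THEN iffD2]) auto
        moreover have "real n + 1 \<le> (real n + 1)\<^sup>2" by (simp add: power2_eq_square)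
        ultimately show ?thesis unfolding L_def power_mult_distrib by (intro mult_mono) auto
      qed
      ultimately show False using a by linarith
    qed
  qed
  have qpos: "q (g (s, x)) > 0" if "0 \<le> s" "s \<le> L + 1" "x \<in> S" for s x
  proof -
    from that have "\<exists>i\<le>n. g (s, x) i \<noteq> 0" by (rule g0)
    then obtain i where "i \<le> n" "g (s, x) i \<noteq> 0" by blast
    then have "(\<Sum>i\<le>n. (g (s, x) i)\<^sup>2) > 0"
      by (intro sum_pos2[of _ i]) auto
    then show ?thesis unfolding q_def by simp
  qed
  define h where "h = (\<lambda>(t::real, x). \<lambda>i. g ((1 - t) * (L + 1), x) i / q (g ((1 - t) * (L + 1), x)))"
  have sc: "0 \<le> (1 - t) * (L + 1)" "(1 - t) * (L + 1) \<le> L + 1" if "t \<in> {0..1}" for t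
    using that L by (auto simp: mult_le_cancel_right1 mult_left_le_one_le)
  have coord: "continuous_on ({0..1::real} \<times> S) (\<lambda>w. snd w i)" for i
    by (rule continuous_on_product_then_coordinatewise) (intro continuous_intros)
  have fcont: "continuous_on ({0..1} \<times> S) (\<lambda>w. f (\<lambda>j. (1 - fst w) * (L + 1) * snd w j) i)" for i
  proof -
    have "continuous_on ({0..1} \<times> S) (\<lambda>w. f (\<lambda>j. (1 - fst w) * (L + 1) * snd w j))"
    proof (rule continuous_on_compose2[OF cont])
      show "continuous_on ({0..1} \<times> S) (\<lambda>w j. (1 - fst w) * (L + 1) * snd w j)"
        by (intro continuous_on_coordinatewise_then_product continuous_intros coord)
    qed (use SE in auto)
    then show ?thesis by (rule continuous_on_product_then_coordinatewise)
  qed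
  have gcont: "continuous_on ({0..1} \<times> S) (\<lambda>w. g ((1 - fst w) * (L + 1), snd w) i)" for i
    unfolding g_def \<phi>_def prod.case by (intro continuous_intros coord fcont)
  have hcont: "continuous_on ({0..1} \<times> S) h"
  proof (rule continuous_on_coordinatewise_then_product)
    fix i
    have qc: "continuous_on ({0..1} \<times> S) (\<lambda>w. q (g ((1 - fst w) * (L + 1), snd w)))"
      unfolding q_def by (intro continuous_intros gcont)
    have "q (g ((1 - fst w) * (L + 1), snd w)) \<noteq> 0" if "w \<in> {0..1} \<times> S" for w
      using qpos[OF sc, of "fst w" "snd w"] that by (auto simp: mem_Times_iff)
    then have "continuous_on ({0..1} \<times> S)
        (\<lambda>w. g ((1 - fst w) * (L + 1), snd w) i / q (g ((1 - fst w) * (L + 1), snd w)))"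
      using continuous_on_divide[OF gcont qc] by blast
    then show "continuous_on ({0..1} \<times> S) (\<lambda>w. h w i)"
      unfolding h_def by (simp add: case_prod_beta)
  qed
  have hS: "h (t, x) \<in> S" if "t \<in> {0..1}" "x \<in> S" for t x
  proof -
    let ?z = "g ((1 - t) * (L + 1), x)"
    have "q ?z > 0" using qpos sc that by blast
    moreover have "(\<Sum>i\<le>n. (?z i)\<^sup>2) = (q ?z)\<^sup>2" unfolding q_def by (simp add: sum_nonneg)
    ultimately have "(\<Sum>i\<le>n. (?z i / q ?z)\<^sup>2) = 1"
      by (simp only: power_divide flip: sum_divide_distrib) simp
    moreover have "?z i = 0" if "i > n" for i
      using gE[OF \<open>x \<in> S\<close>, of "(1 - t) * (L + 1)"] that unfolding E_def by blast
    ultimately show ?thesis unfolding S_def h_def by simp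
  qed
  have h0: "h (0, x) = x" if "x \<in> S" for x
  proof -
    have "g (L + 1, x) = (\<lambda>i. (L + 1) * x i)" unfolding g_def \<phi>_def by simp
    moreover have "q (\<lambda>i. (L + 1) * x i) = L + 1"
      using that L unfolding q_def S_def by (simp add: power_mult_distrib flip: sum_distrib_left)
    ultimately show ?thesis unfolding h_def using L by auto
  qed
  have h1: "h (1, x) = (\<lambda>i. (- f (\<lambda>_. 0) i) / q (\<lambda>i. - f (\<lambda>_. 0) i))" for x
    unfolding h_def g_def \<phi>_def using L by simp
  have "homotopic_with (\<lambda>x. True) (top_of_set S) (top_of_set S) id
      (\<lambda>x i. (- f (\<lambda>_. 0) i) / q (\<lambda>i. - f (\<lambda>_. 0) i))"
  proof (subst homotopic_with)
    have "continuous_map (prod_topology (top_of_set {0..1::real}) (top_of_set S)) (top_of_set S) h"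
      using hcont hS by (simp add: prod_topology_subtopology_eu continuous_map_in_subtopology Pi_iff image_subset_iff)
    then show "\<exists>h. continuous_map (prod_topology (top_of_set {0..1::real}) (top_of_set S)) (top_of_set S) h \<and>
        (\<forall>x\<in>topspace (top_of_set S). h (0, x) = id x) \<and>
        (\<forall>x\<in>topspace (top_of_set S). h (1, x) = (\<lambda>i. (- f (\<lambda>_. 0) i) / q (\<lambda>i. - f (\<lambda>_. 0) i))) \<and>
        (\<forall>t\<in>{0..1}. True)"
      using h0 h1 by (auto intro!: exI[of _ h])
  qed simp
  then have "contractible S" unfolding contractible_def by blast
  then show False using sphere_not_contractible[of n] unfolding S_def by blast
qed

section \<open>Inequalities for powers\<close>

lemma abs_add_same_sign: "0 \<le> a * b \<Longrightarrow> \<bar>a + b\<bar> = \<bar>a\<bar> + \<bar>b\<bar>" for a b :: real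
  by (auto simp: zero_le_mult_iff)

text \<open>
  Increments of a convex function grow: shifting the interval \<open>[x, x + b]\<close> from \<open>x = a\<close> to \<open>x = a + c\<close>
  increases the increment of \<open>x powr p\<close>.
\<close>

lemma powr_increment_mono:
  fixes a b c p :: real
  assumes "1 \<le> p" "0 \<le> a" "0 \<le> b" "0 \<le> c"
  shows "(a + b) powr p + (a + c) powr p \<le> a powr p + (a + b + c) powr p"
proof -
  define F where "F x = (x + b) powr p - x powr p" for x :: real
  have "F a \<le> F (a + c)"
  proof (rule DERIV_nonneg_imp_increasing_open[of a "a + c" F])
    show "a \<le> a + c" using assms by simp
  next
    fix x assume x: "a < x" "x < a + c"
    then have "(F has_real_derivative p * (x + b) powr (p - 1) - p * x powr (p - 1)) (at x)"
      unfolding F_def using assms by (auto intro!: derivative_eq_intros)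
    moreover have "p * x powr (p - 1) \<le> p * (x + b) powr (p - 1)"
      using assms x by (intro mult_left_mono powr_mono2) auto
    ultimately show "\<exists>y. (F has_real_derivative y) (at x) \<and> 0 \<le> y"
      by (intro exI conjI) auto
  next
    show "continuous_on {a..a + c} F"
      unfolding F_def using assms by (intro continuous_intros continuous_on_powr') auto
  qed
  then show ?thesis unfolding F_def by (simp add: algebra_simps)
qed

lemma powr_superadditive:
  fixes a b p :: real
  assumes "1 \<le> p" "0 \<le> a" "0 \<le> b"
  shows "a powr p + b powr p \<le> (a + b) powr p"
  using powr_increment_mono[of p 0 a b] assms by simp

lemma powr_convex_combination:
  fixes s t x y p :: real
  assumes "1 \<le> p" "0 \<le> x" "0 \<le> y" "0 \<le> s" "0 \<le> t" "s + t = 1"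
  shows "(s * x + t * y) powr p \<le> s * x powr p + t * y powr p"
proof -
  have *: "s powr p \<le> s" if "0 \<le> s" "s \<le> 1" for s
    using that assms(1) powr_mono'[of 1 p s] by auto
  consider "x = 0" | "y = 0" | "x > 0" "y > 0" using assms by linarith
  then show ?thesis
  proof cases
    case 1
    then show ?thesis using assms *[of t] by (auto simp: powr_mult intro: mult_right_mono)
  next
    case 2
    then show ?thesis using assms *[of s] by (auto simp: powr_mult intro: mult_right_mono)
  next
    case 3
    moreover have "s = 1 - t" using assms(6) by simp
    ultimately show ?thesis
      using convex_onD[OF powr_convex[OF assms(1)], of t x y] assms(4,5) by simp
  qed
qed

lemma powr_lipschitz:
  fixes a b p M :: real
  assumes "1 \<le> p" "0 \<le> a" "a \<le> M" "0 \<le> b" "b \<le> M"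
  shows "\<bar>a powr p - b powr p\<bar> \<le> p * M powr (p - 1) * \<bar>a - b\<bar>"
proof -
  have *: "b powr p - a powr p \<le> p * M powr (p - 1) * (b - a)" if "a \<le> b" "0 \<le> a" "b \<le> M" for a b
  proof -
    define F where "F x = p * M powr (p - 1) * x - x powr p" for x :: real
    have "F a \<le> F b"
    proof (rule DERIV_nonneg_imp_increasing_open[OF \<open>a \<le> b\<close>, of F])
      fix x assume x: "a < x" "x < b"
      then have "(F has_real_derivative p * M powr (p - 1) - p * x powr (p - 1)) (at x)"
        unfolding F_def using assms that by (auto intro!: derivative_eq_intros)
      moreover have "p * x powr (p - 1) \<le> p * M powr (p - 1)"
        using assms x that by (intro mult_left_mono powr_mono2) auto
      ultimately show "\<exists>y. (F has_real_derivative y) (at x) \<and> 0 \<le> y"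
        by (intro exI conjI) auto
    next
      show "continuous_on {a..b} F"
        unfolding F_def using assms(1) that by (intro continuous_intros continuous_on_powr') auto
    qed
    then show ?thesis unfolding F_def by (simp add: algebra_simps)
  qed
  have mono: "a powr p \<le> b powr p" if "a \<le> b" "0 \<le> a" for a b :: real
    using that assms by (intro powr_mono2) auto
  show ?thesis
  proof (cases "a \<le> b")
    case True
    then have "\<bar>a powr p - b powr p\<bar> = b powr p - a powr p" "\<bar>a - b\<bar> = b - a"
      using mono[of a b] assms by auto
    then show ?thesis using *[of a b] True assms by metis
  next
    case False
    then have "\<bar>a powr p - b powr p\<bar> = a powr p - b powr p" "\<bar>a - b\<bar> = a - b"
      using mono[of b a] assms by auto
    then show ?thesis using *[of b a] False assms by (metis nle_le)
  qed
qed

lemma powr_bernoulli: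
  fixes r u :: real
  assumes "0 \<le> r" "r \<le> 1" "0 < u"
  shows "u powr r \<le> 1 + r * (u - 1)"
proof -
  have "exp ((1 - r) *\<^sub>R 0 + r *\<^sub>R ln u) \<le> (1 - r) * exp 0 + r * exp (ln u)"
    using assms by (intro convex_onD[OF exp_convex]) auto
  then show ?thesis using assms by (simp add: powr_def algebra_simps)
qed

lemma powr_mean_ge:
  fixes a b p :: real
  assumes "1 \<le> p" "0 \<le> a" "0 \<le> b"
  shows "2 powr (1 / p) / 2 * (a + b) \<le> (a powr p + b powr p) powr (1 / p)"
proof -
  have "((a + b) / 2) powr p \<le> (a powr p + b powr p) / 2"
    using powr_convex_combination[of p a b "1/2" "1/2"] assms by (simp add: add_divide_distrib)
  then have "(((a + b) / 2) powr p) powr (1 / p) \<le> ((a powr p + b powr p) / 2) powr (1 / p)"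
    using assms by (intro powr_mono2) auto
  then have "(a + b) / 2 \<le> (a powr p + b powr p) powr (1 / p) / 2 powr (1 / p)"
    using assms by (simp add: powr_powr powr_divide)
  then show ?thesis by (simp add: field_simps)
qed

text \<open>
  The second bound is the limit of \<open>displacement_estimate\<close> as \<open>s\<close> tends to \<open>a / k\<close>, with the
  \<open>p\<close>-mean of \<open>A\<close> and \<open>1 - \<sigma>\<close> replaced by their arithmetic mean. The first bound ensures that every
  \<open>s < a / k\<close> leaves \<open>\<sigma> y + g\<close> inside the ball, since \<open>a \<le> 2\<close>.
\<close>

section \<open>The spaces of p-summable sequences\<close>

definition psum :: "real \<Rightarrow> (nat \<Rightarrow> real) \<Rightarrow> real" where
  "psum p x = suminf (\<lambda>i. \<bar>x i\<bar> powr p)"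

definition trunc :: "nat \<Rightarrow> (nat \<Rightarrow> real) \<Rightarrow> nat \<Rightarrow> real" where
  "trunc n x i = (if i < n then x i else 0)"

definition tail :: "nat \<Rightarrow> (nat \<Rightarrow> real) \<Rightarrow> nat \<Rightarrow> real" where
  "tail n x i = (if i < n then 0 else x i)"

lemma lp_norm_psum: "lp_norm p x = psum p x powr (1 / p)"
  by (simp add: lp_norm_def psum_def)

lemma lp_summable: "x \<in> lp p \<Longrightarrow> summable (\<lambda>i. \<bar>x i\<bar> powr p)"
  by (simp add: lp_def)

lemma psum_nonneg: "x \<in> lp p \<Longrightarrow> 0 \<le> psum p x"
  unfolding psum_def by (rule suminf_nonneg[OF lp_summable]) auto

lemma lp_norm_nonneg: "0 \<le> lp_norm p x"
  by (simp add: lp_norm_psum)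

context
  fixes p :: real
  assumes p: "1 \<le> p"
begin

lemma norm_powr: "x \<in> lp p \<Longrightarrow> lp_norm p x powr p = psum p x"
  using p psum_nonneg[of x p] by (simp add: lp_norm_psum powr_powr)

lemma norm_le_iff: "x \<in> lp p \<Longrightarrow> 0 \<le> c \<Longrightarrow> lp_norm p x \<le> c \<longleftrightarrow> psum p x \<le> c powr p"
  using p lp_norm_nonneg[of p x] powr_mono2[of p "lp_norm p x" c] powr_less_mono2[of p c "lp_norm p x"]
  by (cases "lp_norm p x \<le> c") (simp_all add: norm_powr)

lemma norm_eq_iff: "x \<in> lp p \<Longrightarrow> 0 \<le> c \<Longrightarrow> lp_norm p x = c \<longleftrightarrow> psum p x = c powr p"
  using p norm_powr[of x] by (auto simp: lp_norm_psum powr_powr)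

lemma psum_mono:
  assumes "y \<in> lp p" "\<And>i. \<bar>x i\<bar> \<le> \<bar>y i\<bar>"
  shows "x \<in> lp p" "psum p x \<le> psum p y"
proof -
  have le: "\<bar>x i\<bar> powr p \<le> \<bar>y i\<bar> powr p" for i using assms(2) p by (intro powr_mono2) auto
  have s: "summable (\<lambda>i. \<bar>x i\<bar> powr p)"
    by (rule summable_comparison_test'[OF lp_summable[OF assms(1)]]) (use le in auto)
  then show "x \<in> lp p" by (simp add: lp_def)
  show "psum p x \<le> psum p y"
    unfolding psum_def by (rule suminf_le[OF le s lp_summable[OF assms(1)]])
qed

lemma lp_scale: "x \<in> lp p \<Longrightarrow> (\<lambda>i. c * x i) \<in> lp p"
  and psum_scale: "x \<in> lp p \<Longrightarrow> psum p (\<lambda>i. c * x i) = \<bar>c\<bar> powr p * psum p x"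
  by (auto simp: lp_def psum_def abs_mult powr_mult intro!: summable_mult suminf_mult)

lemma norm_scale: "x \<in> lp p \<Longrightarrow> lp_norm p (\<lambda>i. c * x i) = \<bar>c\<bar> * lp_norm p x"
  using p psum_nonneg[of x p] by (simp add: norm_eq_iff lp_norm_nonneg lp_scale psum_scale powr_mult norm_powr)

lemma psum_uminus: "psum p (- x) = psum p x" and lp_uminus: "x \<in> lp p \<Longrightarrow> - x \<in> lp p"
  by (simp_all add: psum_def lp_def)

lemma psum_minus_commute: "psum p (x - y) = psum p (y - x)"
  by (simp add: psum_def abs_minus_commute)

lemma norm_uminus: "lp_norm p (- x) = lp_norm p x"
  by (simp add: lp_norm_psum psum_uminus)

lemma norm_minus_commute: "lp_norm p (x - y) = lp_norm p (y - x)"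
  by (simp add: lp_norm_psum psum_minus_commute)

lemma lp_zero: "(\<lambda>_. 0) \<in> lp p" and psum_zero: "psum p (\<lambda>_. 0) = 0"
  by (simp_all add: psum_def lp_def)

lemma psum_eq_0: "x \<in> lp p \<Longrightarrow> psum p x = 0 \<Longrightarrow> x i = 0"
  using suminf_eq_zero_iff[OF lp_summable, of x p] by (simp add: psum_def)

lemma coordinate_le_norm:
  assumes "x \<in> lp p" shows "\<bar>x i\<bar> \<le> lp_norm p x"
proof -
  have "\<bar>x i\<bar> powr p \<le> psum p x"
    unfolding psum_def using sum_le_suminf[OF lp_summable[OF assms], of "{i}"] by simp
  then have "(\<bar>x i\<bar> powr p) powr (1 / p) \<le> psum p x powr (1 / p)"
    using p by (intro powr_mono2) auto
  then show ?thesis using p by (simp add: powr_powr lp_norm_psum)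
qed

lemma lp_add_norm_triangle:
  assumes x: "x \<in> lp p" and y: "y \<in> lp p"
  shows "x + y \<in> lp p" and "lp_norm p (x + y) \<le> lp_norm p x + lp_norm p y"
proof -
  define a where "a = lp_norm p x"
  define b where "b = lp_norm p y"
  have ab: "0 \<le> a" "0 \<le> b" unfolding a_def b_def by (auto simp: lp_norm_nonneg)
  have "x + y \<in> lp p \<and> lp_norm p (x + y) \<le> a + b"
  proof (cases "a = 0 \<or> b = 0")
    case True
    then consider "\<And>i. x i = 0" | "\<And>i. y i = 0"
      using coordinate_le_norm[OF x] coordinate_le_norm[OF y] unfolding a_def b_def by fastforce
    then have "x + y = y \<and> (\<forall>i. x i = 0) \<or> x + y = x \<and> (\<forall>i. y i = 0)"
      by cases auto
    then show ?thesis using x y ab unfolding a_def b_def by auto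
  next
    case False
    with ab have pos: "a > 0" "b > 0" by auto
    \<comment> \<open>Convexity of the power, applied to the unit vectors \<open>x / a\<close> and \<open>y / b\<close> with weights
      proportional to \<open>a\<close> and \<open>b\<close>, gives a summable majorant whose sum is exactly \<open>(a + b) powr p\<close>.\<close>
    let ?g = "\<lambda>i. (a + b) powr p * (a / (a + b) * (\<bar>x i\<bar> powr p / a powr p) + b / (a + b) * (\<bar>y i\<bar> powr p / b powr p))"
    have le: "\<bar>(x + y) i\<bar> powr p \<le> ?g i" for i
    proof -
      have "\<bar>(x + y) i\<bar> \<le> (a + b) * (a / (a + b) * (\<bar>x i\<bar> / a) + b / (a + b) * (\<bar>y i\<bar> / b))"
        using pos by (simp add: distrib_left abs_triangle_ineq)
      then have "\<bar>(x + y) i\<bar> powr p \<le> ((a + b) * (a / (a + b) * (\<bar>x i\<bar> / a) + b / (a + b) * (\<bar>y i\<bar> / b))) powr p"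
        using p by (intro powr_mono2) auto
      also have "\<dots> = (a + b) powr p * (a / (a + b) * (\<bar>x i\<bar> / a) + b / (a + b) * (\<bar>y i\<bar> / b)) powr p"
        using pos by (simp add: powr_mult)
      also have "\<dots> \<le> (a + b) powr p * (a / (a + b) * (\<bar>x i\<bar> / a) powr p + b / (a + b) * (\<bar>y i\<bar> / b) powr p)"
        using pos p
        by (intro mult_left_mono powr_convex_combination) (simp_all flip: add_divide_distrib)
      also have "\<dots> = ?g i" using pos by (simp add: powr_divide)
      finally show ?thesis .
    qed
    have sx: "(\<lambda>i. \<bar>x i\<bar> powr p) sums a powr p" and sy: "(\<lambda>i. \<bar>y i\<bar> powr p) sums b powr p"
      using summable_sums[OF lp_summable[OF x]] summable_sums[OF lp_summable[OF y]]
      unfolding a_def b_def norm_powr[OF x] norm_powr[OF y] psum_def by auto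
    have "?g sums ((a + b) powr p * (a / (a + b) * (a powr p / a powr p) + b / (a + b) * (b powr p / b powr p)))"
      by (intro sums_mult sums_add sums_divide sx sy)
    then have sg: "?g sums ((a + b) powr p)"
    proof -
      have "a / (a + b) + b / (a + b) = 1" using pos by (simp flip: add_divide_distrib)
      with \<open>?g sums _\<close> show ?thesis using pos by simp
    qed
    have s: "summable (\<lambda>i. \<bar>(x + y) i\<bar> powr p)"
      by (rule summable_comparison_test'[OF sums_summable[OF sg]]) (use le in auto)
    have "psum p (x + y) \<le> (a + b) powr p"
      unfolding psum_def using suminf_le[OF le s sums_summable[OF sg]] sums_unique[OF sg] by simp
    then show ?thesis using s ab by (simp add: norm_le_iff lp_def)
  qed
  then show "x + y \<in> lp p" "lp_norm p (x + y) \<le> lp_norm p x + lp_norm p y"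
    unfolding a_def b_def by auto
qed

lemmas lp_add = lp_add_norm_triangle(1)
lemmas norm_triangle = lp_add_norm_triangle(2)

lemma lp_diff: "x \<in> lp p \<Longrightarrow> y \<in> lp p \<Longrightarrow> x - y \<in> lp p"
  using lp_add[of x "- y"] lp_uminus[of y] by simp

lemma norm_triangle_diff: "x \<in> lp p \<Longrightarrow> y \<in> lp p \<Longrightarrow> lp_norm p (x - y) \<le> lp_norm p x + lp_norm p y"
  using norm_triangle[of x "- y"] lp_uminus[of y] norm_uminus[of y] by simp

lemma norm_reverse_triangle:
  assumes "x \<in> lp p" "y \<in> lp p" shows "lp_norm p x - lp_norm p y \<le> lp_norm p (x - y)"
  using norm_triangle[of "x - y" y] lp_diff[OF assms] assms by simp

text \<open>
  Many norm estimates below hold coordinate by coordinate, but only after another sequence is added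
  on both sides.
\<close>

lemma psum_add_mono:
  assumes "a \<in> lp p" "b \<in> lp p" "c \<in> lp p" "d \<in> lp p"
    and "\<And>i. \<bar>a i\<bar> powr p + \<bar>b i\<bar> powr p \<le> \<bar>c i\<bar> powr p + \<bar>d i\<bar> powr p"
  shows "psum p a + psum p b \<le> psum p c + psum p d"
proof -
  note s = assms(1-4)[THEN lp_summable]
  show ?thesis
    unfolding psum_def suminf_add[OF s(1,2)] suminf_add[OF s(3,4)]
    by (rule suminf_le[OF assms(5) summable_add[OF s(1,2)] summable_add[OF s(3,4)]])
qed

lemma lp_finite: "\<forall>i\<ge>n. x i = 0 \<Longrightarrow> x \<in> lp p"
  and psum_finite: "\<forall>i\<ge>n. x i = 0 \<Longrightarrow> psum p x = (\<Sum>i<n. \<bar>x i\<bar> powr p)"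
  unfolding lp_def psum_def
  by (auto intro!: summable_finite[of "{..<n}"] suminf_finite; meson not_le)+

lemma lp_trunc: "trunc n x \<in> lp p" and psum_trunc: "psum p (trunc n x) = (\<Sum>i<n. \<bar>x i\<bar> powr p)"
proof -
  show "trunc n x \<in> lp p" by (rule lp_finite[of n]) (simp add: trunc_def)
  have "psum p (trunc n x) = (\<Sum>i<n. \<bar>trunc n x i\<bar> powr p)" by (rule psum_finite) (simp add: trunc_def)
  then show "psum p (trunc n x) = (\<Sum>i<n. \<bar>x i\<bar> powr p)" by (simp add: trunc_def)
qed

lemma lp_tail: "x \<in> lp p \<Longrightarrow> tail n x \<in> lp p"
  by (rule psum_mono(1)) (auto simp: tail_def)

lemma psum_split:
  assumes "x \<in> lp p" shows "psum p x = psum p (trunc n x) + psum p (tail n x)"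
proof -
  have "psum p (trunc n x) + psum p (tail n x) = suminf (\<lambda>i. \<bar>trunc n x i\<bar> powr p + \<bar>tail n x i\<bar> powr p)"
    unfolding psum_def by (rule suminf_add) (intro lp_summable lp_trunc lp_tail assms)+
  also have "\<dots> = psum p x"
    unfolding psum_def by (rule arg_cong[of _ _ suminf]) (auto simp: trunc_def tail_def p)
  finally show ?thesis by simp
qed

lemma psum_trunc_le: "x \<in> lp p \<Longrightarrow> psum p (trunc n x) \<le> psum p x"
  by (rule psum_mono(2)) (auto simp: trunc_def)

lemma psum_trunc_tendsto: "x \<in> lp p \<Longrightarrow> (\<lambda>n. psum p (trunc n x)) \<longlonglongrightarrow> psum p x"
  unfolding psum_trunc unfolding psum_def by (rule summable_LIMSEQ[OF lp_summable])

lemma psum_tail_tendsto: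
  assumes "x \<in> lp p" shows "(\<lambda>n. psum p (tail n x)) \<longlonglongrightarrow> 0"
proof -
  have "psum p (tail n x) = psum p x - psum p (trunc n x)" for n
    using psum_split[OF assms, of n] by simp
  then show ?thesis
    using tendsto_diff[OF tendsto_const[of "psum p x"] psum_trunc_tendsto[OF assms]] by simp
qed

lemma norm_tail_tendsto: "x \<in> lp p \<Longrightarrow> (\<lambda>n. lp_norm p (tail n x)) \<longlonglongrightarrow> 0"
  using tendsto_powr'[OF psum_tail_tendsto tendsto_const[of "1 / p"], of x] p psum_nonneg[OF lp_tail]
  by (simp add: lp_norm_psum)

end

section \<open>Fixed points and weak limits in sequence spaces\<close>

context
  fixes p :: real
  assumes p: "1 \<le> p"
begin

lemma norm_0: "lp_norm p (\<lambda>_. 0) = 0"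
  by (simp add: lp_norm_psum psum_zero[OF p])

lemma norm_continuous_finite:
  assumes "\<And>x i. x \<in> K \<Longrightarrow> n \<le> i \<Longrightarrow> u x i = 0"
    and "\<And>i. continuous_on K (\<lambda>x. u x i)"
  shows "continuous_on K (\<lambda>x. lp_norm p (u x))"
proof -
  have "lp_norm p (u x) = (\<Sum>i<n. \<bar>u x i\<bar> powr p) powr (1 / p)" if "x \<in> K" for x
    using psum_finite[OF p, of n "u x"] assms(1)[OF that] by (simp add: lp_norm_psum)
  moreover have "continuous_on K (\<lambda>x. (\<Sum>i<n. \<bar>u x i\<bar> powr p) powr (1 / p))"
    by (intro continuous_on_powr' continuous_intros assms(2)) (use p in \<open>auto intro: sum_nonneg\<close>)
  ultimately show ?thesis by (simp cong: continuous_on_cong)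
qed

text \<open>
  Radial clipping retracts the whole finite-dimensional space onto the ball, so that the map extends
  to a bounded map on the space, whose fixed points are those of the original map.
\<close>

lemma brouwer_lp_ball:
  fixes f :: "(nat \<Rightarrow> real) \<Rightarrow> nat \<Rightarrow> real" and n :: nat
  defines "K s \<equiv> {x. (\<forall>i\<ge>n. x i = 0) \<and> lp_norm p x \<le> s}"
  assumes s: "0 < s" and cont: "\<And>i. continuous_on (K s) (\<lambda>x. f x i)" and maps: "f \<in> K s \<rightarrow> K s"
  shows "\<exists>x\<in>K s. f x = x"
proof (cases n)
  case 0
  then have *: "x \<in> K s \<longleftrightarrow> x = (\<lambda>_. 0)" for x
    using s by (auto simp: K_def norm_0)
  then show ?thesis using maps by (metis PiE)
next
  case (Suc m)
  define E :: "(nat \<Rightarrow> real) set" where "E = {x. \<forall>i>m. x i = 0}"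
  have E: "x \<in> E \<longleftrightarrow> (\<forall>i\<ge>n. x i = 0)" for x unfolding E_def Suc by (simp add: Suc_le_eq)
  define clip where "clip x i = s / max s (lp_norm p x) * x i" for x :: "nat \<Rightarrow> real" and i
  have coord: "continuous_on E (\<lambda>x. x i)" for i
    by (rule continuous_on_product_then_coordinatewise) (rule continuous_on_id)
  have nc: "continuous_on E (lp_norm p)"
    by (rule norm_continuous_finite[of E n]) (use E coord in auto)
  have cc: "continuous_on E clip"
    by (rule continuous_on_coordinatewise_then_product, unfold clip_def)
      (intro continuous_intros coord nc; use s in auto)
  have lpE: "x \<in> lp p" if "x \<in> E" for x
    using that E lp_finite[OF p] by blast
  have clipK: "clip x \<in> K s" if "x \<in> E" for x
  proof -
    have "lp_norm p (clip x) = s / max s (lp_norm p x) * lp_norm p x"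
      unfolding clip_def using s by (subst norm_scale[OF p lpE[OF that]]) auto
    also have "\<dots> \<le> s" using s by (auto simp: max_def field_simps lp_norm_nonneg)
    finally show ?thesis using that unfolding K_def E clip_def by simp
  qed
  have KE: "K s \<subseteq> E" unfolding K_def using E by auto
  have "\<exists>x\<in>{x. \<forall>i>m. x i = 0}. (f \<circ> clip) x = x"
  proof (rule brouwer_bounded)
    show "continuous_on {x. \<forall>i>m. x i = 0} (f \<circ> clip)"
      unfolding E_def[symmetric]
    proof (rule continuous_on_compose[OF cc])
      show "continuous_on (clip ` E) f"
        by (rule continuous_on_subset[of "K s"])
          (use clipK cont in \<open>auto intro: continuous_on_coordinatewise_then_product\<close>)
    qed
    show "f \<circ> clip \<in> {x. \<forall>i>m. x i = 0} \<rightarrow> {x. \<forall>i>m. x i = 0}"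
      unfolding E_def[symmetric] using clipK maps KE by fastforce
    show "\<bar>(f \<circ> clip) x i\<bar> \<le> s" if "x \<in> {x. \<forall>i>m. x i = 0}" for x i
    proof -
      have *: "f (clip x) \<in> K s" using that clipK maps unfolding E_def by blast
      then have "f (clip x) \<in> lp p" using lpE KE by blast
      from coordinate_le_norm[OF p this, of i] * show ?thesis unfolding K_def by simp
    qed
  qed
  then obtain x where x: "x \<in> E" "f (clip x) = x" unfolding E_def by auto
  then have "x \<in> K s" using clipK maps by (metis PiE)
  moreover from this have "clip x = x" using s unfolding clip_def K_def by auto
  ultimately show ?thesis using x by auto
qed

lemma lipschitz_imp_continuous_coordinate:
  assumes K: "\<And>x i. x \<in> K \<Longrightarrow> n \<le> i \<Longrightarrow> x i = 0"
    and G: "\<And>x. x \<in> K \<Longrightarrow> G x \<in> lp p"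
    and lip: "\<And>x y. x \<in> K \<Longrightarrow> y \<in> K \<Longrightarrow> lp_norm p (G x - G y) \<le> c * lp_norm p (x - y)"
  shows "continuous_on K (\<lambda>x. G x i)"
  unfolding continuous_on_def
proof
  fix y assume y: "y \<in> K"
  have coord: "continuous_on K (\<lambda>x. x i)" for i
    by (rule continuous_on_product_then_coordinatewise) (rule continuous_on_id)
  have "continuous_on K (\<lambda>x. lp_norm p (x - y))"
  proof (rule norm_continuous_finite[of K n])
    show "(x - y) i = 0" if "x \<in> K" "n \<le> i" for x i using K[OF that] K[OF y that(2)] by simp
    show "continuous_on K (\<lambda>x. (x - y) i)" for i by (auto intro!: continuous_intros coord)
  qed
  then have "((\<lambda>x. lp_norm p (x - y)) \<longlongrightarrow> lp_norm p (y - y)) (at y within K)"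
    using y unfolding continuous_on_def by blast
  moreover have "y - y = (\<lambda>_. 0)" by auto
  ultimately have "((\<lambda>x. c * lp_norm p (x - y)) \<longlongrightarrow> 0) (at y within K)"
    using tendsto_mult[OF tendsto_const] norm_0 by fastforce
  moreover have "\<forall>\<^sub>F x in at y within K. norm (G x i - G y i) \<le> c * lp_norm p (x - y)"
    unfolding eventually_at_filter
  proof (rule always_eventually, intro allI impI)
    fix x assume "x \<in> K"
    then show "norm (G x i - G y i) \<le> c * lp_norm p (x - y)"
      using coordinate_le_norm[OF p lp_diff[OF p G G], of x y i] lip[of x y] y by simp
  qed
  ultimately have "((\<lambda>x. G x i - G y i) \<longlongrightarrow> 0) (at y within K)"
    by (rule Lim_null_comparison[rotated])
  then show "((\<lambda>x. G x i) \<longlongrightarrow> G y i) (at y within K)" by (rule LIM_zero_cancel)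
qed

text \<open>
  A sequence that tends to 0 coordinatewise eventually lives where \<open>h\<close> is negligible, so the \<open>p\<close>-th
  powers of the norms add up in the limit (the Brezis--Lieb lemma). The proof cuts at an index \<open>m\<close>
  beyond which \<open>h\<close> is small: below \<open>m\<close> there are finitely many coordinates, above \<open>m\<close> adding \<open>h\<close>
  hardly changes the norm.
\<close>

lemma brezis_lieb:
  assumes u: "\<And>n. u n \<in> lp p" and C: "\<And>n. lp_norm p (u n) \<le> C"
    and lim: "\<And>i. (\<lambda>n. u n i) \<longlonglongrightarrow> 0" and h: "h \<in> lp p"
  shows "(\<lambda>n. psum p (u n + h) - psum p (u n)) \<longlonglongrightarrow> psum p h"
proof (rule LIMSEQ_I)
  fix e :: real assume e: "0 < e"
  define L where "L = p * (C + lp_norm p h) powr (p - 1)"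
  have "(\<lambda>m. L * lp_norm p (tail m h) + psum p (tail m h)) \<longlonglongrightarrow> L * 0 + 0"
    by (intro tendsto_intros norm_tail_tendsto psum_tail_tendsto p h)
  then have "\<forall>\<^sub>F m in sequentially. L * lp_norm p (tail m h) + psum p (tail m h) < e / 2"
    using e by (intro order_tendstoD(2)[where a = "e / 2"]) auto
  then obtain m where m: "L * lp_norm p (tail m h) + psum p (tail m h) < e / 2"
    using eventually_happens by fastforce
  have "(\<lambda>n. \<Sum>i<m. \<bar>u n i + h i\<bar> powr p - \<bar>u n i\<bar> powr p - \<bar>h i\<bar> powr p)
      \<longlonglongrightarrow> (\<Sum>i<m. \<bar>0 + h i\<bar> powr p - \<bar>0\<bar> powr p - \<bar>h i\<bar> powr p)"
    by (intro tendsto_sum tendsto_diff tendsto_powr' tendsto_rabs tendsto_add lim tendsto_const)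
      (use p in auto)
  then have "(\<lambda>n. \<Sum>i<m. \<bar>u n i + h i\<bar> powr p - \<bar>u n i\<bar> powr p - \<bar>h i\<bar> powr p) \<longlonglongrightarrow> 0"
    using p by simp
  from LIMSEQ_D[OF this, of "e / 2"] e obtain n0 where n0: "\<And>n. n \<ge> n0 \<Longrightarrow>
      \<bar>\<Sum>i<m. \<bar>u n i + h i\<bar> powr p - \<bar>u n i\<bar> powr p - \<bar>h i\<bar> powr p\<bar> < e / 2"
    by auto
  show "\<exists>no. \<forall>n\<ge>no. norm (psum p (u n + h) - psum p (u n) - psum p h) < e"
  proof (intro exI allI impI)
    fix n assume n: "n \<ge> n0"
    have uh: "u n + h \<in> lp p" by (rule lp_add[OF p u h])
    have tl: "tail m (u n + h) = tail m (u n) + tail m h" by (auto simp: tail_def)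
    have t: "tail m (u n) \<in> lp p" "tail m h \<in> lp p" "tail m (u n + h) \<in> lp p"
      using lp_tail[OF p] u h uh by blast+
    let ?A = "lp_norm p (tail m (u n + h))" and ?B = "lp_norm p (tail m (u n))"
    have AB: "\<bar>?A - ?B\<bar> \<le> lp_norm p (tail m h)"
    proof -
      have "tail m (u n) = tail m (u n + h) - tail m h" unfolding tl by simp
      then have "?B \<le> ?A + lp_norm p (tail m h)"
        using norm_triangle_diff[OF p t(3,2)] by metis
      then show ?thesis using norm_triangle[OF p t(1,2)] unfolding tl by linarith
    qed
    have tle: "lp_norm p (tail m x) \<le> lp_norm p x" if "x \<in> lp p" for x
      using that p psum_split[OF p that, of m] psum_nonneg[OF lp_trunc[OF p], of m x]
      by (simp add: norm_le_iff lp_tail lp_norm_nonneg norm_powr)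
    have B: "?B \<le> C" using tle[OF u] C order_trans by blast
    have A: "?A \<le> C + lp_norm p h" using norm_triangle[OF p u[of n] h] tle[OF uh] C[of n] by linarith
    have "\<bar>?A powr p - ?B powr p\<bar> \<le> L * \<bar>?A - ?B\<bar>"
      unfolding L_def using A B by (intro powr_lipschitz p) (auto simp: lp_norm_nonneg add_increasing2)
    also have "\<dots> \<le> L * lp_norm p (tail m h)"
      unfolding L_def using p by (intro mult_left_mono AB) auto
    finally have T: "\<bar>psum p (tail m (u n + h)) - psum p (tail m (u n))\<bar> \<le> L * lp_norm p (tail m h)"
      using t p by (simp add: norm_powr)
    have "psum p (u n + h) - psum p (u n) - psum p h =
        (\<Sum>i<m. \<bar>u n i + h i\<bar> powr p - \<bar>u n i\<bar> powr p - \<bar>h i\<bar> powr p)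
        + (psum p (tail m (u n + h)) - psum p (tail m (u n))) - psum p (tail m h)"
      unfolding psum_split[OF p uh, of m] psum_split[OF p u, of n m] psum_split[OF p h, of m]
        psum_trunc[OF p] by (simp add: sum_subtractf)
    then show "norm (psum p (u n + h) - psum p (u n) - psum p h) < e"
      using T m n0[OF n] psum_nonneg[OF t(2)] unfolding real_norm_def by linarith
  qed
qed

end

section \<open>Points that a retraction maps away from themselves\<close>

context
  fixes p k :: real and R :: "(nat \<Rightarrow> real) \<Rightarrow> nat \<Rightarrow> real"
  assumes p: "1 \<le> p" and R: "lipschitz_retraction (lp p) (lp_norm p) k R" and k: "0 < k"
begin

lemma retract_in_lp: "x \<in> lp p \<Longrightarrow> lp_norm p x \<le> 1 \<Longrightarrow> R x \<in> lp p"
  and norm_retract: "x \<in> lp p \<Longrightarrow> lp_norm p x \<le> 1 \<Longrightarrow> lp_norm p (R x) = 1"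
  and retract_id: "x \<in> lp p \<Longrightarrow> lp_norm p x = 1 \<Longrightarrow> R x = x"
  and retract_lip: "x \<in> lp p \<Longrightarrow> lp_norm p x \<le> 1 \<Longrightarrow> y \<in> lp p \<Longrightarrow> lp_norm p y \<le> 1 \<Longrightarrow>
    lp_norm p (R x - R y) \<le> k * lp_norm p (x - y)"
  using R unfolding lipschitz_retraction_def unit_ball_def unit_sphere_def by (auto simp: Pi_iff)

lemma finite_antipodal_point:
  assumes \<sigma>: "0 \<le> \<sigma>" "\<sigma> \<le> 1"
  shows "\<exists>x. x \<in> lp p \<and> lp_norm p x \<le> 1 \<and> x = (\<lambda>i. - \<sigma> * trunc n (R x) i)"
proof -
  define K where "K = {x. (\<forall>i\<ge>n. x i = 0) \<and> lp_norm p x \<le> 1}"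
  have K: "x \<in> lp p" "lp_norm p x \<le> 1" if "x \<in> K" for x
    using that lp_finite[OF p] unfolding K_def by blast+
  define f where "f x = (\<lambda>i. - \<sigma> * trunc n (R x) i)" for x
  have "\<exists>x\<in>K. f x = x"
    unfolding K_def
  proof (rule brouwer_lp_ball[OF p])
    have c: "continuous_on K (\<lambda>x. R x i)" for i
    proof (rule lipschitz_imp_continuous_coordinate[OF p, where n = n and c = k])
      show "x i = 0" if "x \<in> K" "n \<le> i" for x i using that unfolding K_def by blast
      show "R x \<in> lp p" if "x \<in> K" for x by (rule retract_in_lp[OF K[OF that]])
      show "lp_norm p (R x - R y) \<le> k * lp_norm p (x - y)" if "x \<in> K" "y \<in> K" for x y
        by (rule retract_lip[OF K[OF that(1)] K[OF that(2)]])
    qed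
    show "continuous_on {x. (\<forall>i\<ge>n. x i = 0) \<and> lp_norm p x \<le> 1} (\<lambda>x. f x i)" for i
      unfolding K_def[symmetric] f_def trunc_def by (cases "i < n") (auto intro!: continuous_intros c)
    show "f \<in> {x. (\<forall>i\<ge>n. x i = 0) \<and> lp_norm p x \<le> 1} \<rightarrow> {x. (\<forall>i\<ge>n. x i = 0) \<and> lp_norm p x \<le> 1}"
      unfolding K_def[symmetric]
    proof
      fix x assume x: "x \<in> K"
      have "psum p (trunc n (R x)) \<le> 1"
        using psum_trunc_le[OF p retract_in_lp[OF K[OF x]], of n]
          norm_powr[OF p retract_in_lp[OF K[OF x]]] norm_retract[OF K[OF x]] by simp
      then have "lp_norm p (trunc n (R x)) \<le> 1" using norm_le_iff[OF p lp_trunc[OF p], of 1] by simp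
      then have "lp_norm p (f x) \<le> 1"
        unfolding f_def norm_scale[OF p lp_trunc[OF p]]
        using \<sigma> mult_le_one[OF \<sigma>(2) lp_norm_nonneg] by simp
      then show "f x \<in> K" unfolding K_def by (auto simp: f_def trunc_def)
    qed
  qed simp
  then show ?thesis using K unfolding f_def by metis
qed

text \<open>
  The truncated solutions \<open>x n\<close> have images \<open>Y n\<close> that converge coordinatewise, along a subsequence,
  to some \<open>y\<close>. Let \<open>D = 1 - psum p y\<close> be the amount of \<open>p\<close>-th power of the norm that escapes to
  infinity and let \<open>z\<close> be the image of the limit point \<open>- \<sigma> * y\<close>. The distance of \<open>Y n\<close> to \<open>z\<close>
  captures the escaping part and \<open>y - z\<close>, whereas the distance of \<open>x n\<close> to \<open>- \<sigma> * y\<close> captures only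
  \<open>\<sigma>\<close> times the escaping part. Hence \<open>psum p (y - z) + D \<le> (k * \<sigma>) powr p * D\<close>. This forces
  \<open>D = 0\<close> and \<open>y = z\<close> if \<open>k * \<sigma> < 1\<close>. In \<open>l\<^sub>1\<close> also \<open>psum p (y - z) \<ge> D\<close>, since \<open>z\<close> is a unit
  vector and \<open>y\<close> has norm \<open>1 - D\<close>; so \<open>k * \<sigma> < 2\<close> is enough.
\<close>

lemma antipodal_point:
  assumes \<sigma>: "0 \<le> \<sigma>" "\<sigma> \<le> 1" and small: "k * \<sigma> < 1 \<or> p = 1 \<and> k * \<sigma> < 2"
  shows "\<exists>y. y \<in> lp p \<and> lp_norm p y = 1 \<and> R (\<lambda>i. - \<sigma> * y i) = y"
proof -
  obtain x where x: "\<And>n. x n \<in> lp p" "\<And>n. lp_norm p (x n) \<le> 1"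
    and x_eq: "\<And>n. x n = (\<lambda>i. - \<sigma> * trunc n (R (x n)) i)"
    using finite_antipodal_point[OF \<sigma>] by metis
  define Y where "Y n = R (x n)" for n
  have Y: "Y n \<in> lp p" "lp_norm p (Y n) = 1" for n
    unfolding Y_def using retract_in_lp norm_retract x by auto
  then have psY: "psum p (Y n) = 1" for n using norm_powr[OF p Y(1)] by (metis powr_one_eq_one)
  have Yb: "norm (Y n i) \<le> 1" for n i using coordinate_le_norm[OF p Y(1)] Y(2) by (metis real_norm_def)
  obtain r where r: "strict_mono r" and conv: "\<And>i. \<exists>l. (\<lambda>n. Y (r n) i) \<longlonglongrightarrow> l"
    by (rule function_convergent_subsequence[of UNIV Y 1]) (use Yb in auto)
  obtain y where y: "\<And>i. (\<lambda>n. Y (r n) i) \<longlonglongrightarrow> y i" using conv by metis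
  have part: "(\<Sum>i<m. \<bar>y i\<bar> powr p) \<le> 1" for m
  proof (rule LIMSEQ_le_const2)
    show "(\<lambda>n. \<Sum>i<m. \<bar>Y (r n) i\<bar> powr p) \<longlonglongrightarrow> (\<Sum>i<m. \<bar>y i\<bar> powr p)"
      by (intro tendsto_sum tendsto_powr' tendsto_rabs y tendsto_const) (use p in auto)
    show "\<exists>N. \<forall>n\<ge>N. (\<Sum>i<m. \<bar>Y (r n) i\<bar> powr p) \<le> 1"
      using psum_trunc_le[OF p Y(1)] unfolding psum_trunc[OF p] psY by blast
  qed
  have ylp: "y \<in> lp p"
    unfolding lp_def using part by (auto intro!: summableI_nonneg_bounded[where x = 1])
  have ps_y: "psum p y \<le> 1"
    using LIMSEQ_le_const2[OF psum_trunc_tendsto[OF p ylp]] part unfolding psum_trunc[OF p] by blast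
  have Ny: "lp_norm p y \<le> 1" using ps_y by (simp add: norm_le_iff[OF p ylp])
  define q where "q = (\<lambda>i. - \<sigma> * y i)"
  have q: "q \<in> lp p" unfolding q_def by (rule lp_scale[OF p ylp])
  have Nq: "lp_norm p q \<le> 1"
    unfolding q_def norm_scale[OF p ylp] using \<sigma> Ny by (auto intro: mult_le_one simp: lp_norm_nonneg)
  define z where "z = R q"
  have z: "z \<in> lp p" "lp_norm p z = 1" unfolding z_def using retract_in_lp norm_retract q Nq by auto
  define u where "u n = Y (r n) - y" for n
  have u: "u n \<in> lp p" for n unfolding u_def using lp_diff[OF p Y(1) ylp] .
  have u2: "lp_norm p (u n) \<le> 2" for n
    unfolding u_def using norm_triangle_diff[OF p Y(1) ylp] Y(2) Ny by (smt (verit))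
  have u0: "(\<lambda>n. u n i) \<longlonglongrightarrow> 0" for i
    unfolding u_def using tendsto_diff[OF y[of i] tendsto_const[of "y i"]] by simp
  \<comment> \<open>With \<open>h = y\<close> this measures the escaping part, with \<open>h = y - z\<close> the distance to \<open>z\<close>.\<close>
  have "(\<lambda>n. psum p (u n + y) - psum p (u n)) \<longlonglongrightarrow> psum p y"
    by (rule brezis_lieb[OF p u u2 u0 ylp])
  then have "(\<lambda>n. 1 - psum p (u n)) \<longlonglongrightarrow> psum p y" unfolding u_def by (simp add: psY)
  from tendsto_diff[OF tendsto_const[of 1] this]
  have lim_u: "(\<lambda>n. psum p (u n)) \<longlonglongrightarrow> 1 - psum p y" by simp
  have "(\<lambda>n. psum p (u n + (y - z)) - psum p (u n)) \<longlonglongrightarrow> psum p (y - z)"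
    by (rule brezis_lieb[OF p u u2 u0 lp_diff[OF p ylp z(1)]])
  from tendsto_add[OF this lim_u]
  have lim_Yz: "(\<lambda>n. psum p (Y (r n) - z)) \<longlonglongrightarrow> psum p (y - z) + (1 - psum p y)"
    unfolding u_def by simp
  have bound: "psum p (Y (r n) - z) \<le> (k * \<sigma>) powr p * (psum p (u n) + psum p (tail (r n) y))" for n
  proof -
    define t where "t = trunc (r n) (Y (r n)) - y"
    have t: "t \<in> lp p" unfolding t_def by (intro lp_diff lp_trunc p ylp)
    have "x (r n) - q = (\<lambda>i. - \<sigma> * t i)"
      by (subst x_eq) (auto simp: q_def t_def Y_def algebra_simps)
    then have "lp_norm p (x (r n) - q) = \<sigma> * lp_norm p t"
      using \<sigma> by (simp only: norm_scale[OF p t]) simp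
    then have "lp_norm p (Y (r n) - z) \<le> k * \<sigma> * lp_norm p t"
      using retract_lip[OF x q Nq, of "r n"] unfolding Y_def z_def by (simp add: mult.assoc)
    then have "psum p (Y (r n) - z) \<le> (k * \<sigma> * lp_norm p t) powr p"
      using norm_le_iff[OF p lp_diff[OF p Y(1) z(1)]] k \<sigma> by (simp add: lp_norm_nonneg)
    also have "\<dots> = (k * \<sigma>) powr p * psum p t"
      using k \<sigma> by (simp add: powr_mult lp_norm_nonneg norm_powr[OF p t])
    also have "psum p t \<le> psum p (u n) + psum p (tail (r n) y)"
    proof -
      have "trunc (r n) t = trunc (r n) (u n)" unfolding t_def u_def trunc_def by auto
      moreover have "psum p (tail (r n) t) = psum p (tail (r n) y)"
        unfolding psum_def t_def tail_def trunc_def by (rule arg_cong[of _ _ suminf]) auto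
      ultimately show ?thesis
        using psum_split[OF p t, of "r n"] psum_trunc_le[OF p u, of "r n" n] by simp
    qed
    finally show ?thesis by (simp add: mult_left_mono)
  qed
  have "(\<lambda>n. psum p (tail (r n) y)) \<longlonglongrightarrow> 0"
    using LIMSEQ_subseq_LIMSEQ[OF psum_tail_tendsto[OF p ylp] r] by (simp add: o_def)
  then have lim_b: "(\<lambda>n. (k * \<sigma>) powr p * (psum p (u n) + psum p (tail (r n) y)))
      \<longlonglongrightarrow> (k * \<sigma>) powr p * ((1 - psum p y) + 0)"
    by (intro tendsto_intros lim_u)
  define D where "D = 1 - psum p y"
  have key: "psum p (y - z) + D \<le> (k * \<sigma>) powr p * D"
    using LIMSEQ_le[OF lim_Yz lim_b] bound unfolding D_def by auto
  have D0: "0 \<le> D" unfolding D_def using ps_y by simp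
  have yz0: "0 \<le> psum p (y - z)" by (rule psum_nonneg[OF lp_diff[OF p ylp z(1)]])
  have "D = 0 \<and> psum p (y - z) = 0"
    using small
  proof
    assume "k * \<sigma> < 1"
    then have "(k * \<sigma>) powr p < 1" using k \<sigma> p powr_less_mono2[of p "k * \<sigma>" 1] by simp
    then have "(1 - (k * \<sigma>) powr p) * D \<ge> 0" "1 - (k * \<sigma>) powr p > 0" using D0 by auto
    moreover have "(1 - (k * \<sigma>) powr p) * D + psum p (y - z) \<le> 0" using key by (simp add: algebra_simps)
    ultimately have "(1 - (k * \<sigma>) powr p) * D = 0" "psum p (y - z) = 0" using yz0 by linarith+
    then show ?thesis using \<open>1 - (k * \<sigma>) powr p > 0\<close> by simp
  next
    assume p1: "p = 1 \<and> k * \<sigma> < 2"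
    have "psum p x = lp_norm p x" if "x \<in> lp p" for x
      using norm_powr[OF p that] p1 lp_norm_nonneg[of p x] by simp
    then have ge: "D \<le> psum p (y - z)"
      using norm_reverse_triangle[OF p z(1) ylp] z ylp lp_diff[OF p ylp z(1)]
      unfolding D_def norm_minus_commute[OF p, of z y] by simp
    have le: "psum p (y - z) + D \<le> k * \<sigma> * D" using key p1 k \<sigma> by simp
    have "D = 0"
    proof (rule ccontr)
      assume "D \<noteq> 0"
      then have "k * \<sigma> * D < 2 * D" using p1 D0 by (intro mult_strict_right_mono) auto
      then show False using ge le by linarith
    qed
    then show ?thesis using le yz0 by simp
  qed
  then have "psum p y = 1" "y = z"
    using psum_eq_0[OF p lp_diff[OF p ylp z(1)]] unfolding D_def by (auto simp: fun_eq_iff)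
  then show ?thesis using z ylp unfolding z_def q_def by auto
qed

text \<open>
  The retraction fixes \<open>- y\<close> and sends the nearby point \<open>- \<sigma> * y\<close> to the opposite unit vector \<open>y\<close>.
\<close>

lemma antipodal_displacement:
  assumes "0 \<le> \<sigma>" "\<sigma> \<le> 1" "y \<in> lp p" "lp_norm p y = 1" "R (\<lambda>i. - \<sigma> * y i) = y"
  shows "2 \<le> k * (1 - \<sigma>)"
proof -
  have *: "- y \<in> lp p" "lp_norm p (- y) = 1" "(\<lambda>i. - \<sigma> * y i) \<in> lp p" "lp_norm p (\<lambda>i. - \<sigma> * y i) \<le> 1"
    using assms lp_scale[OF p assms(3), of "- \<sigma>"] by (simp_all add: lp_uminus[OF p] norm_uminus[OF p] norm_scale[OF p assms(3), of "- \<sigma>", simplified])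
  have "R (- y) - R (\<lambda>i. - \<sigma> * y i) = (\<lambda>i. - 2 * y i)"
    unfolding assms(5) retract_id[OF *(1,2)] by auto
  moreover have "- y - (\<lambda>i. - \<sigma> * y i) = (\<lambda>i. - (1 - \<sigma>) * y i)" by (auto simp: algebra_simps)
  ultimately show ?thesis
    using retract_lip[OF *(1) _ *(3,4)] *(2) assms
    by (simp only: norm_scale[OF p assms(3)]) simp
qed

text \<open>
  Only the part \<open>c g\<close> of the image \<open>Y g\<close> that does not oppose \<open>y\<close>, cut to the first \<open>n\<close> coordinates,
  may be used as a direction: the vector \<open>\<sigma> y + g\<close> must not be shortened by cancellation. That part
  is nonzero: otherwise \<open>Y g\<close> would be disjoint from or opposite to \<open>y\<close>, up to a small tail, and thus
  at distance nearly \<open>2 powr (1 / p)\<close> from it, while \<open>Y g\<close> and \<open>y\<close> are the images of two points at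
  distance at most \<open>s\<close>. So normalizing it to length \<open>s\<close> gives a continuous self-map of a ball, and a
  fixed point of this map is the required \<open>g\<close>.
\<close>

lemma aligned_perturbation:
  assumes \<sigma>: "0 \<le> \<sigma>" and y: "y \<in> lp p" "lp_norm p y = 1" and fixed: "R (\<lambda>i. - \<sigma> * y i) = y"
    and s: "0 < s" "k * s < 2 powr (1 / p)" "\<sigma> + s \<le> 1"
  shows "\<exists>g. g \<in> lp p \<and> lp_norm p g = s \<and> (\<forall>i. 0 \<le> g i * y i) \<and>
    (\<forall>i. 0 \<le> g i * R (\<lambda>i. - (\<sigma> * y i + g i)) i) \<and>
    (\<forall>i. g i \<noteq> 0 \<longrightarrow> 0 \<le> R (\<lambda>i. - (\<sigma> * y i + g i)) i * y i)"
proof -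
  note rlp = retract_in_lp and rnorm = norm_retract and rlip = retract_lip
  have "(\<lambda>n. (1 + psum p (trunc n y)) powr (1 / p) - lp_norm p (tail n y))
      \<longlonglongrightarrow> (1 + psum p y) powr (1 / p) - 0"
    by (intro tendsto_intros psum_trunc_tendsto norm_tail_tendsto p y)
      (use psum_nonneg[OF y(1)] in auto)
  moreover have "psum p y = 1" using norm_powr[OF p y(1)] y(2) by simp
  ultimately have "\<forall>\<^sub>F n in sequentially. k * s < (1 + psum p (trunc n y)) powr (1 / p) - lp_norm p (tail n y)"
    using s by (intro order_tendstoD(1)) auto
  then obtain n where n: "k * s < (1 + psum p (trunc n y)) powr (1 / p) - lp_norm p (tail n y)"
    using eventually_happens by fastforce
  define K where "K = {g. (\<forall>i\<ge>n. g i = 0) \<and> lp_norm p g \<le> s}"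
  have K: "g \<in> lp p" "lp_norm p g \<le> s" if "g \<in> K" for g
    using that lp_finite[OF p] unfolding K_def by blast+
  define X where "X g = (\<lambda>i. - (\<sigma> * y i + g i))" for g
  define q where "q = (\<lambda>i. - \<sigma> * y i)"
  have q: "q \<in> lp p" "lp_norm p q = \<sigma>"
    unfolding q_def norm_scale[OF p y(1)] using \<sigma> y(2) lp_scale[OF p y(1), of "- \<sigma>"] by auto
  have Xq: "X g = q - g" for g unfolding X_def q_def by auto
  have X: "X g \<in> lp p" "lp_norm p (X g) \<le> 1" if "g \<in> K" for g
    using lp_diff[OF p q(1) K(1)[OF that]] norm_triangle_diff[OF p q(1) K(1)[OF that]]
      K(2)[OF that] q(2) s(3)
    unfolding Xq by simp_all
  define Y where "Y g = R (X g)" for g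
  define c where "c g i = (if i < n \<and> 0 \<le> Y g i * y i then Y g i else 0)" for g i
  \<comment> \<open>Written without reference to the product \<open>Y g i * y i\<close>, the continuity in \<open>g\<close> is visible.\<close>
  have c_alt: "c g i = (if i < n then if y i > 0 then max (Y g i) 0 else if y i < 0 then min (Y g i) 0
      else Y g i else 0)" for g i
    unfolding c_def by (auto simp: zero_le_mult_iff max_def min_def)
  have Ycont: "continuous_on K (\<lambda>g. Y g i)" for i
  proof (rule lipschitz_imp_continuous_coordinate[OF p, where n = n and c = k])
    show "x i = 0" if "x \<in> K" "n \<le> i" for x i using that unfolding K_def by blast
    show "Y g \<in> lp p" if "g \<in> K" for g unfolding Y_def by (rule rlp[OF X[OF that]])
    show "lp_norm p (Y g - Y h) \<le> k * lp_norm p (g - h)" if "g \<in> K" "h \<in> K" for g h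
    proof -
      have "X g - X h = h - g" unfolding Xq by simp
      then show ?thesis
        using rlip[OF X[OF that(1)] X[OF that(2)]] unfolding Y_def norm_minus_commute[OF p, of g h] by simp
    qed
  qed
  have ccont: "continuous_on K (\<lambda>g. c g i)" for i
    unfolding c_alt
    by (cases "i < n"; cases "0 < y i"; cases "y i < 0")
      (simp_all add: continuous_on_max continuous_on_min Ycont)
  have cfin: "\<And>g i. n \<le> i \<Longrightarrow> c g i = 0" unfolding c_def by auto
  have clp: "c g \<in> lp p" for g by (rule lp_finite[OF p, of n]) (simp add: cfin)
  have cpos: "lp_norm p (c g) > 0" if g: "g \<in> K" for g
  proof (rule ccontr)
    assume "\<not> ?thesis"
    then have "lp_norm p (c g) = 0" using lp_norm_nonneg[of p "c g"] by simp
    then have c0: "c g i = 0" for i using coordinate_le_norm[OF p clp, of g i] by simp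
    have Yg: "Y g \<in> lp p" "lp_norm p (Y g) = 1" unfolding Y_def using rlp rnorm X[OF g] by auto
    have "psum p (Y g) + psum p (trunc n y) \<le> psum p (Y g - trunc n y) + psum p (\<lambda>_. 0)"
    proof (rule psum_add_mono[OF p])
      fix i
      have "\<not> i < n \<or> Y g i = 0 \<or> Y g i * y i < 0"
        using c0[of i] unfolding c_def by (auto split: if_splits)
      then have "\<bar>(Y g - trunc n y) i\<bar> = \<bar>Y g i\<bar> + \<bar>trunc n y i\<bar>"
        by (auto simp: trunc_def mult_less_0_iff)
      then show "\<bar>Y g i\<bar> powr p + \<bar>trunc n y i\<bar> powr p \<le> \<bar>(Y g - trunc n y) i\<bar> powr p + \<bar>0\<bar> powr p"
        using powr_superadditive[OF p, of "\<bar>Y g i\<bar>" "\<bar>trunc n y i\<bar>"] p by simp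
    qed (intro Yg lp_trunc lp_diff lp_zero p)+
    then have "1 + psum p (trunc n y) \<le> psum p (Y g - trunc n y)"
      using norm_powr[OF p Yg(1)] Yg(2) psum_zero[OF p] by simp
    then have "(1 + psum p (trunc n y)) powr (1 / p) \<le> lp_norm p (Y g - trunc n y)"
      unfolding lp_norm_psum using p psum_nonneg[OF lp_trunc[OF p]] by (intro powr_mono2) auto
    moreover have "Y g - trunc n y = (Y g - y) + tail n y"
      by (auto simp: trunc_def tail_def)
    then have "lp_norm p (Y g - trunc n y) \<le> lp_norm p (Y g - y) + lp_norm p (tail n y)"
      using norm_triangle[OF p lp_diff[OF p Yg(1) y(1)] lp_tail[OF p y(1), of n]] by (simp only:)
    moreover have "R q = y" using fixed unfolding q_def .
    then have "lp_norm p (Y g - y) \<le> k * lp_norm p (X g - q)"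
      using rlip[OF X[OF g] q(1)] q(2) s unfolding Y_def by simp
    moreover have "X g - q = - g" unfolding Xq by simp
    then have "lp_norm p (X g - q) \<le> s" using K(2)[OF g] norm_uminus[OF p, of g] by simp
    then have "k * lp_norm p (X g - q) \<le> k * s" using k by simp
    ultimately show False using n by linarith
  qed
  define f where "f g = (\<lambda>i. s / lp_norm p (c g) * c g i)" for g
  have fnorm: "lp_norm p (f g) = s" if "g \<in> K" for g
    unfolding f_def norm_scale[OF p clp] using cpos[OF that] s by simp
  have "\<exists>g\<in>K. f g = g"
    unfolding K_def
  proof (rule brouwer_lp_ball[OF p s(1)])
    have nc: "continuous_on K (\<lambda>g. lp_norm p (c g))"
      by (rule norm_continuous_finite[OF p, of K n]) (use cfin ccont in auto)
    have "\<forall>g\<in>K. lp_norm p (c g) \<noteq> 0" using cpos by fastforce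
    then have "continuous_on K (\<lambda>g. f g i)" for i
      unfolding f_def
      by (intro continuous_on_mult continuous_on_divide continuous_on_const nc ccont)
    then show "continuous_on {g. (\<forall>i\<ge>n. g i = 0) \<and> lp_norm p g \<le> s} (\<lambda>g. f g i)" for i
      unfolding K_def .
    show "f \<in> {g. (\<forall>i\<ge>n. g i = 0) \<and> lp_norm p g \<le> s} \<rightarrow> {g. (\<forall>i\<ge>n. g i = 0) \<and> lp_norm p g \<le> s}"
      unfolding K_def[symmetric]
    proof
      fix g assume "g \<in> K"
      then show "f g \<in> K" using fnorm cfin unfolding K_def by (simp add: f_def)
    qed
  qed
  then obtain g where g: "g \<in> K" "f g = g" by blast
  define a where "a = s / lp_norm p (c g)"
  have a: "a > 0" unfolding a_def using s cpos[OF g(1)] by simp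
  have gi: "g i = a * c g i" for i using g(2) unfolding f_def a_def by (metis)
  have c1: "0 \<le> c g i * y i" "0 \<le> c g i * Y g i" "c g i \<noteq> 0 \<Longrightarrow> 0 \<le> Y g i * y i" for i
    unfolding c_def by (auto split: if_splits)
  show ?thesis
  proof (intro exI[of _ g] conjI allI impI)
    show "g \<in> lp p" by (rule K(1)[OF g(1)])
    show "lp_norm p g = s" using fnorm[OF g(1)] g(2) by simp
    show "0 \<le> g i * y i" for i using c1(1)[of i] a unfolding gi[of i] by (simp add: mult.assoc)
    show "0 \<le> g i * R (\<lambda>i. - (\<sigma> * y i + g i)) i" for i
      using c1(2)[of i] a unfolding gi[of i] Y_def X_def by (simp add: mult.assoc)
    show "0 \<le> R (\<lambda>i. - (\<sigma> * y i + g i)) i * y i" if "g i \<noteq> 0" for i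
      using c1(3)[of i] that gi[of i] unfolding Y_def X_def by auto
  qed
qed

text \<open>
  The point \<open>x = - (\<sigma> y + g)\<close> is compared to \<open>w = - (\<sigma> y + t * g)\<close>, where \<open>t \<ge> 1\<close> puts \<open>w\<close> on the
  sphere. Since \<open>g\<close> is aligned with \<open>y\<close>, the vector \<open>t * g\<close> has norm at most \<open>(1 - \<sigma> powr p) powr (1 / p)\<close>,
  which bounds the distance of \<open>w\<close> to \<open>x\<close>. For the distance of \<open>w\<close> to \<open>Y = R x\<close>, the part along \<open>g\<close>
  contributes in full because \<open>Y\<close> points away from it, and the loss on the coordinates where \<open>Y\<close>
  opposes \<open>y\<close> is controlled by \<open>N (\<sigma> y + Y) \<ge> 1 - \<sigma>\<close>.
\<close>

lemma displacement_estimate: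
  assumes \<sigma>: "0 \<le> \<sigma>" "\<sigma> \<le> 1" and y: "y \<in> lp p" "lp_norm p y = 1" and fixed: "R (\<lambda>i. - \<sigma> * y i) = y"
    and s: "0 < s" "k * s < 2 powr (1 / p)" "\<sigma> + s \<le> 1"
  shows "(1 - \<sigma> powr p + (1 - \<sigma>) powr p) powr (1 / p) \<le> k * ((1 - \<sigma> powr p) powr (1 / p) - s)"
proof -
  obtain g where g: "g \<in> lp p" "lp_norm p g = s" and gy: "\<And>i. 0 \<le> g i * y i"
    and gY: "\<And>i. 0 \<le> g i * R (\<lambda>i. - (\<sigma> * y i + g i)) i"
    and Yy: "\<And>i. g i \<noteq> 0 \<Longrightarrow> 0 \<le> R (\<lambda>i. - (\<sigma> * y i + g i)) i * y i"
    using aligned_perturbation[OF \<sigma>(1) y fixed s] by blast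
  define W where "W t = (\<lambda>i. \<sigma> * y i + t * g i)" for t
  define Y where "Y = R (- W 1)"
  have W1: "- W 1 = (\<lambda>i. - (\<sigma> * y i + g i))" unfolding W_def by auto
  note gY = gY[folded W1 Y_def] and Yy = Yy[folded W1 Y_def]
  have Wsum: "W t = (\<lambda>i. \<sigma> * y i) + (\<lambda>i. t * g i)" for t unfolding W_def by auto
  have W: "W t \<in> lp p" for t unfolding Wsum by (intro lp_add lp_scale p y g)
  have Wdiff: "lp_norm p (W t - W u) = \<bar>t - u\<bar> * s" for t u
  proof -
    have "W t - W u = (\<lambda>i. (t - u) * g i)" unfolding W_def by (auto simp: algebra_simps)
    then show ?thesis using norm_scale[OF p g(1), of "t - u"] g(2) by simp
  qed
  have ny: "lp_norm p (\<lambda>i. \<sigma> * y i) = \<sigma>" using norm_scale[OF p y(1), of \<sigma>] y(2) \<sigma> by simp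
  have ng: "lp_norm p (\<lambda>i. t * g i) = t * s" if "0 \<le> t" for t
    using norm_scale[OF p g(1), of t] g(2) that by simp
  have W1le: "lp_norm p (W 1) \<le> 1"
    using norm_triangle[OF p lp_scale[OF p y(1), of \<sigma>] lp_scale[OF p g(1), of 1]] ny ng[of 1] s(3)
    unfolding Wsum by simp
  have "continuous_on {1..(1 + \<sigma>) / s} (\<lambda>t. lp_norm p (W t))"
  proof (rule lipschitz_on_continuous_on)
    show "s-lipschitz_on {1..(1 + \<sigma>) / s} (\<lambda>t. lp_norm p (W t))"
    proof (rule lipschitz_onI)
      fix t u
      show "dist (lp_norm p (W t)) (lp_norm p (W u)) \<le> s * dist t u"
        using norm_reverse_triangle[OF p W[of t] W[of u]] norm_reverse_triangle[OF p W[of u] W[of t]]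
          Wdiff[of t u] Wdiff[of u t]
        by (simp add: dist_real_def abs_minus_commute mult.commute abs_le_iff)
    qed (use s in simp)
  qed
  moreover have "1 \<le> lp_norm p (W ((1 + \<sigma>) / s))"
  proof -
    have "(\<lambda>i. (1 + \<sigma>) / s * g i) = W ((1 + \<sigma>) / s) - (\<lambda>i. \<sigma> * y i)" unfolding Wsum by simp
    then have "lp_norm p (\<lambda>i. (1 + \<sigma>) / s * g i) \<le> lp_norm p (W ((1 + \<sigma>) / s)) + \<sigma>"
      using norm_triangle_diff[OF p W lp_scale[OF p y(1), of \<sigma>]] ny by metis
    then show ?thesis using ng[of "(1 + \<sigma>) / s"] s \<sigma> by simp
  qed
  moreover have "1 \<le> (1 + \<sigma>) / s" using s \<sigma> by simp
  ultimately obtain t where t: "1 \<le> t" "lp_norm p (W t) = 1"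
    using IVT'[of "\<lambda>t. lp_norm p (W t)" 1 1 "(1 + \<sigma>) / s"] W1le by auto
  define w where "w = - W t"
  have w: "w \<in> lp p" "lp_norm p w = 1" unfolding w_def using lp_uminus[OF p W] norm_uminus[OF p] t by auto
  have x: "- W 1 \<in> lp p" "lp_norm p (- W 1) \<le> 1" using lp_uminus[OF p W] norm_uminus[OF p] W1le by auto
  have Ylp: "Y \<in> lp p" "lp_norm p Y = 1"
    unfolding Y_def using retract_in_lp[OF x] norm_retract[OF x] by auto
  have "w - - W 1 = W 1 - W t" unfolding w_def by simp
  then have upper: "lp_norm p (w - Y) \<le> k * ((t - 1) * s)"
    using retract_lip[OF w(1) _ x] w(2) Wdiff[of 1 t] t(1) retract_id[OF w]
    unfolding Y_def by simp
  define A where "A = (1 - \<sigma> powr p) powr (1 / p)"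
  have sp: "\<sigma> powr p \<le> 1" using \<sigma> p powr_mono2[of p \<sigma> 1] by simp
  have Ap: "A powr p = 1 - \<sigma> powr p" unfolding A_def using p sp by (simp add: powr_powr)
  have ps: "psum p (\<lambda>i. \<sigma> * y i) = \<sigma> powr p"
    using norm_powr[OF p lp_scale[OF p y(1), of \<sigma>]] ny by simp
  have "psum p (\<lambda>i. \<sigma> * y i) + psum p (\<lambda>i. t * g i) \<le> psum p (W t) + psum p (\<lambda>_. 0)"
  proof (rule psum_add_mono[OF p])
    fix i
    have "0 \<le> (\<sigma> * y i) * (t * g i)"
      using mult_nonneg_nonneg[of "\<sigma> * t" "g i * y i"] gy[of i] \<sigma> t(1) by (simp add: ac_simps)
    then have "\<bar>W t i\<bar> = \<bar>\<sigma> * y i\<bar> + \<bar>t * g i\<bar>"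
      unfolding W_def by (rule abs_add_same_sign)
    then show "\<bar>\<sigma> * y i\<bar> powr p + \<bar>t * g i\<bar> powr p \<le> \<bar>W t i\<bar> powr p + \<bar>0\<bar> powr p"
      using powr_superadditive[OF p, of "\<bar>\<sigma> * y i\<bar>" "\<bar>t * g i\<bar>"] by simp
  qed (intro lp_scale y g W lp_zero p)+
  moreover have "psum p (W t) = 1" using norm_powr[OF p W] t(2) by (metis powr_one_eq_one)
  moreover have "psum p (\<lambda>i. t * g i) = (t * s) powr p"
    using norm_powr[OF p lp_scale[OF p g(1), of t]] ng[of t] t(1) by simp
  ultimately have "(t * s) powr p \<le> A powr p" unfolding Ap using ps psum_zero[OF p] by simp
  moreover have "A powr p < (t * s) powr p" if "A < t * s"
    using p that unfolding A_def by (intro powr_less_mono2) auto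
  ultimately have ts: "t * s \<le> A" by linarith
  \<comment> \<open>Off the support of \<open>g\<close> this is an equality; on it all the signs agree and convexity of the
    power gives the inequality.\<close>
  have "psum p w + psum p (\<lambda>i. \<sigma> * y i + Y i) \<le> psum p (w - Y) + psum p (\<lambda>i. \<sigma> * y i)"
  proof (rule psum_add_mono[OF p])
    fix i
    show "\<bar>w i\<bar> powr p + \<bar>\<sigma> * y i + Y i\<bar> powr p \<le> \<bar>(w - Y) i\<bar> powr p + \<bar>\<sigma> * y i\<bar> powr p"
    proof (cases "g i = 0")
      case True
      then have "w i = - (\<sigma> * y i)" "(w - Y) i = - (\<sigma> * y i + Y i)"
        unfolding w_def W_def by simp_all
      then show ?thesis by (simp only: abs_minus_cancel)
    next
      case False
      have s1: "0 \<le> g i * y i" "0 \<le> g i * Y i" "0 \<le> Y i * y i" using gy gY Yy[OF False] by auto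
      have eq: "\<bar>w i\<bar> = \<sigma> * \<bar>y i\<bar> + t * \<bar>g i\<bar>" "\<bar>\<sigma> * y i + Y i\<bar> = \<sigma> * \<bar>y i\<bar> + \<bar>Y i\<bar>"
        "\<bar>(w - Y) i\<bar> = \<sigma> * \<bar>y i\<bar> + t * \<bar>g i\<bar> + \<bar>Y i\<bar>"
      proof -
        consider "g i > 0" "y i \<ge> 0" "Y i \<ge> 0" | "g i < 0" "y i \<le> 0" "Y i \<le> 0"
          using s1 False by (auto simp: zero_le_mult_iff)
        then have "\<bar>w i\<bar> = \<sigma> * \<bar>y i\<bar> + t * \<bar>g i\<bar> \<and> \<bar>\<sigma> * y i + Y i\<bar> = \<sigma> * \<bar>y i\<bar> + \<bar>Y i\<bar>
            \<and> \<bar>(w - Y) i\<bar> = \<sigma> * \<bar>y i\<bar> + t * \<bar>g i\<bar> + \<bar>Y i\<bar>"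
        proof cases
          case 1
          then have "0 \<le> \<sigma> * y i" "0 \<le> t * g i" using \<sigma> t(1) by auto
          then show ?thesis using 1 unfolding w_def W_def by simp
        next
          case 2
          then have "\<sigma> * y i \<le> 0" "t * g i \<le> 0" using \<sigma> t(1) by (auto simp: mult_le_0_iff)
          then show ?thesis using 2 unfolding w_def W_def by simp
        qed
        then show "\<bar>w i\<bar> = \<sigma> * \<bar>y i\<bar> + t * \<bar>g i\<bar>" "\<bar>\<sigma> * y i + Y i\<bar> = \<sigma> * \<bar>y i\<bar> + \<bar>Y i\<bar>"
          "\<bar>(w - Y) i\<bar> = \<sigma> * \<bar>y i\<bar> + t * \<bar>g i\<bar> + \<bar>Y i\<bar>" by auto
      qed
      show ?thesis
        unfolding eq using powr_increment_mono[OF p, of "\<sigma> * \<bar>y i\<bar>" "t * \<bar>g i\<bar>" "\<bar>Y i\<bar>"] \<sigma> t(1)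
        by (simp add: abs_mult)
    qed
    show "(\<lambda>i. \<sigma> * y i + Y i) \<in> lp p"
      using lp_add[OF p lp_scale[OF p y(1), of \<sigma>] Ylp(1)] by (simp add: plus_fun_def)
  qed (intro lp_scale lp_diff w y Ylp p)+
  moreover have "(1 - \<sigma>) powr p \<le> psum p (\<lambda>i. \<sigma> * y i + Y i)"
  proof -
    have "(\<lambda>i. \<sigma> * y i + Y i) = Y - (\<lambda>i. - \<sigma> * y i)" by auto
    then have "1 - \<sigma> \<le> lp_norm p (\<lambda>i. \<sigma> * y i + Y i)" "(\<lambda>i. \<sigma> * y i + Y i) \<in> lp p"
      using norm_reverse_triangle[OF p Ylp(1) lp_scale[OF p y(1), of "- \<sigma>"]] Ylp(2)
        norm_scale[OF p y(1), of "- \<sigma>"] y(2) \<sigma> lp_diff[OF p Ylp(1) lp_scale[OF p y(1), of "- \<sigma>"]] by auto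
    then show ?thesis using powr_mono2[of p "1 - \<sigma>"] p \<sigma> norm_powr[OF p] by fastforce
  qed
  moreover have "psum p w = 1" using norm_powr[OF p w(1)] w(2) by simp
  ultimately have "1 - \<sigma> powr p + (1 - \<sigma>) powr p \<le> psum p (w - Y)" using ps by linarith
  then have "(1 - \<sigma> powr p + (1 - \<sigma>) powr p) powr (1 / p) \<le> lp_norm p (w - Y)"
    unfolding lp_norm_psum using p sp by (intro powr_mono2) auto
  also note upper
  also have "k * ((t - 1) * s) \<le> k * (A - s)"
    using ts k by (intro mult_left_mono) (auto simp: algebra_simps)
  finally show ?thesis unfolding A_def .
qed

end

section \<open>The lower bound for the Lipschitz constant\<close>

lemma retraction_inequality:
  fixes p k \<sigma> :: real
  assumes p: "1 \<le> p" and R: "lipschitz_retraction (lp p) (lp_norm p) k R" and k: "0 < k"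
    and \<sigma>: "0 \<le> \<sigma>" "\<sigma> \<le> 1" and small: "k * \<sigma> < 1 \<or> p = 1 \<and> k * \<sigma> < 2"
  defines "a \<equiv> 2 powr (1 / p)" and "A \<equiv> (1 - \<sigma> powr p) powr (1 / p)"
  shows "2 \<le> k * (1 - \<sigma>)" and "a + a / 2 * (A + (1 - \<sigma>)) \<le> k * A"
proof -
  obtain y where y: "y \<in> lp p" "lp_norm p y = 1" "R (\<lambda>i. - \<sigma> * y i) = y"
    using antipodal_point[OF p R k \<sigma> small] by blast
  show two: "2 \<le> k * (1 - \<sigma>)" by (rule antipodal_displacement[OF p R k \<sigma> y])
  have a: "0 < a" "a \<le> 2" unfolding a_def using p powr_mono[of "1 / p" 1 "2::real"] by auto
  have sp: "\<sigma> powr p \<le> 1" using \<sigma> p powr_mono2[of p \<sigma> 1] by simp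
  define c where "c = (1 - \<sigma> powr p + (1 - \<sigma>) powr p) powr (1 / p)"
  have est: "c \<le> k * A - t" if t: "0 < t" "t < a" for t
  proof -
    have "t / k \<le> (1 - \<sigma>)" using t a two k by (simp add: divide_le_eq mult.commute)
    then have "c \<le> k * (A - t / k)"
      unfolding A_def c_def
      by (intro displacement_estimate[OF p R k \<sigma> y]) (use t k in \<open>auto simp: a_def\<close>)
    then show ?thesis using k by (simp add: right_diff_distrib)
  qed
  have "c \<le> k * A - a"
  proof (rule ccontr)
    assume "\<not> ?thesis"
    then have "max (k * A - c) 0 < a" using a by auto
    then obtain t where "max (k * A - c) 0 < t" "t < a" using dense by blast
    then show False using est[of t] by auto
  qed
  moreover have "A powr p = 1 - \<sigma> powr p" unfolding A_def using p sp by (simp add: powr_powr)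
  then have "a / 2 * (A + (1 - \<sigma>)) \<le> c"
    using powr_mean_ge[OF p, of A "1 - \<sigma>"] \<sigma> unfolding a_def c_def by (simp add: A_def)
  ultimately show "a + a / 2 * (A + (1 - \<sigma>)) \<le> k * A" by linarith
qed

text \<open>
  The defining equation, raised to the power \<open>p\<close>, becomes additive; in this form its left-hand side is
  visibly decreasing in the root.
\<close>

section \<open>Comparison with the constant kappa\<close>

lemma kappa_equation:
  assumes p: "1 < p"
  shows "1 < kappa p" and "2 / kappa p powr p + 2 / (kappa p - 1) powr p = 1"
proof -
  define K where "K = kappa p"
  have root: "K \<ge> 2 powr (1 / p)" "2 powr (1 / p) / K = (1 - 2 / K powr p) powr (1 / p) * (1 - 1 / K)"
    using kappa_greatest_root(1)[OF p] unfolding kappa_root_def K_def by auto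
  have "1 < 2 powr (1 / p)" using p by (simp add: gr_one_powr)
  then have K: "1 < K" using root(1) by simp
  then show "1 < kappa p" unfolding K_def .
  have "(2 powr (1 / p)) powr p \<le> K powr p" using root(1) p by (intro powr_mono2) auto
  then have "2 \<le> K powr p" using p by (simp add: powr_powr)
  then have nn: "0 \<le> 1 - 2 / K powr p" using K by (simp add: divide_le_eq)
  have "(2 powr (1 / p) / K) powr p = ((1 - 2 / K powr p) powr (1 / p) * (1 - 1 / K)) powr p"
    using root(2) by simp
  then have *: "2 / K powr p = (1 - 2 / K powr p) * (1 - 1 / K) powr p"
    using K p nn by (simp add: powr_divide powr_mult powr_powr)
  have "K - 1 = K * (1 - 1 / K)" using K by (simp add: field_simps)
  then have **: "(K - 1) powr p = K powr p * (1 - 1 / K) powr p" using K by (simp add: powr_mult)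
  have pos: "0 < (1 - 1 / K) powr p" "0 < K powr p" using K by auto
  have "2 / K powr p + 2 / (K - 1) powr p = 1"
    using * pos unfolding ** by (simp add: field_simps)
  then show "2 / kappa p powr p + 2 / (kappa p - 1) powr p = 1" unfolding K_def .
qed

text \<open>
  Both sides vanish at \<open>p = 1\<close>, and linear functions of \<open>x = 1 - 1 / p\<close> separate them: the left-hand side
  is \<open>2 powr x - 1\<close> and stays below the chord of slope \<open>2 * (sqrt 2 - 1) < 0.84\<close> over \<open>[0, 1 / 2]\<close>,
  whereas the right-hand side is at least \<open>d * (2 - d) * x\<close>, and \<open>d * (2 - d) \<ge> 8 / 9\<close>.
\<close>

lemma tangent_gap:
  fixes p d :: real
  assumes p: "1 \<le> p" "p \<le> 2" and d: "2 / 3 \<le> d" "d < 1"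
  shows "2 / 2 powr (1 / p) - 1 \<le> d - d powr p / p"
proof -
  define x where "x = 1 - 1 / p"
  have x: "0 \<le> x" "x \<le> 1 / 2" unfolding x_def using p by (auto simp: field_simps)
  have "sqrt 2 \<le> sqrt (1.42\<^sup>2)" by (intro real_sqrt_le_mono) (simp add: power2_eq_square)
  then have q: "sqrt 2 \<le> 1.42" by simp
  have "2 / 2 powr (1 / p) = 2 powr x" unfolding x_def by (simp add: powr_diff)
  also have "\<dots> = sqrt 2 powr (2 * x)" by (simp add: powr_half_sqrt[symmetric] powr_powr)
  also have "\<dots> \<le> 1 + (2 * x) * (sqrt 2 - 1)" using x by (intro powr_bernoulli) auto
  also have "\<dots> \<le> 1 + x * (0.84)"
    using mult_left_mono[of "2 * (sqrt 2 - 1)" "0.84" x] x q by (simp add: algebra_simps)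
  finally have 1: "2 / 2 powr (1 / p) - 1 \<le> 0.84 * x" by simp
  have "d powr p = d * d powr (p - 1)" using d by (simp add: powr_diff)
  also have "\<dots> \<le> d * (1 + (p - 1) * (d - 1))" using p d by (intro mult_left_mono powr_bernoulli) auto
  finally have "d - d powr p / p \<ge> d - d * (1 + (p - 1) * (d - 1)) / p"
    using p by (simp add: divide_right_mono)
  also have "d - d * (1 + (p - 1) * (d - 1)) / p = d * (2 - d) * x"
    unfolding x_def using p by (simp add: field_simps)
  finally have 2: "d * (2 - d) * x \<le> d - d powr p / p" .
  have "(1 - d)\<^sup>2 \<le> (1 / 3)\<^sup>2" using d by (intro power_mono) auto
  then have "0.84 \<le> d * (2 - d)" by (simp add: power2_eq_square algebra_simps)
  then have "0.84 * x \<le> d * (2 - d) * x" using x by (intro mult_right_mono)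
  then show ?thesis using 1 2 by linarith
qed

text \<open>
  For \<open>1 < p \<le> 2\<close> put \<open>K = kappa p\<close>, \<open>d = 1 - 1 / K\<close> and \<open>v = d powr p\<close>. With \<open>A\<close> as in
  \<open>retraction_inequality\<close> for \<open>\<sigma> = 1 / K\<close>, the equation of \<open>K\<close> gives
  \<open>(K - 1) powr p = 2 * (1 + v)\<close> and \<open>A powr p = (2 + v) / (2 * (1 + v))\<close>. Hence the product
  \<open>A * (K - 1)\<close> is \<open>a * (1 + v / 2) powr (1 / p)\<close>: all the unwieldy terms cancel, and Bernoulli's
  inequality bounds what is left.
\<close>

lemma kappa_le_lipschitz_constant:
  fixes p k :: real
  assumes p: "1 \<le> p" and R: "lipschitz_retraction (lp p) (lp_norm p) k R" and k: "0 < k"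
  shows "kappa p \<le> k"
proof (rule ccontr)
  assume not_le: "\<not> kappa p \<le> k"
  define K where "K = kappa p"
  have less: "k < K" using not_le unfolding K_def by simp
  show False
  proof (cases "p = 1")
    case True
    then have K: "K = 3 + sqrt 5" unfolding K_def kappa_def by simp
    have "K > 3" unfolding K by simp
    \<comment> \<open>\<open>K\<close> is a root of \<open>K * (1 - 2 / K) = 2 + 2 * (1 - 2 / K)\<close>, which is the bound of
      \<open>retraction_inequality\<close> with equality at \<open>\<sigma> = 2 / K\<close>.\<close>
    have sq: "K * K = 6 * K - 4" unfolding K by (simp add: algebra_simps)
    have "k * (2 / K) < 2" using less \<open>K > 3\<close> by (simp add: field_simps)
    then have "2 + 2 / 2 * ((1 - 2 / K) + (1 - 2 / K)) \<le> k * (1 - 2 / K)"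
      using retraction_inequality(2)[OF p R k, of "2 / K"] True \<open>K > 3\<close> by simp
    also have "\<dots> < K * (1 - 2 / K)"
      using less \<open>K > 3\<close> by (intro mult_strict_right_mono) auto
    finally have "4 - 4 / K < K - 2" using \<open>K > 3\<close> by (simp add: right_diff_distrib)
    then have "K * (4 - 4 / K) < K * (K - 2)" using \<open>K > 3\<close> by (intro mult_strict_left_mono) auto
    then have "6 * K - 4 < K * K" using \<open>K > 3\<close> by (simp add: right_diff_distrib)
    then show False using sq by simp
  next
    case False
    then have p1: "1 < p" using p by simp
    have K1: "1 < K" and eq: "2 / K powr p + 2 / (K - 1) powr p = 1"
      unfolding K_def by (rule kappa_equation[OF p1])+
    define a where "a = 2 powr (1 / p)"
    define d where "d = 1 - 1 / K"
    define A where "A = (1 - (1 / K) powr p) powr (1 / p)"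
    have d0: "0 < d" "d < 1" unfolding d_def using K1 by auto
    have "k * (1 / K) < 1" using less K1 by simp
    then have small: "k * (1 / K) < 1 \<or> p = 1 \<and> k * (1 / K) < 2" by blast
    have K01: "0 \<le> 1 / K" "1 / K \<le> 1" using K1 by auto
    note ineqs = retraction_inequality[OF p R k K01 small, folded a_def A_def d_def]
    note two = ineqs(1) and ineq = ineqs(2)
    have "k * d < K * d" using less d0 by simp
    also have "K * d = K - 1" unfolding d_def using K1 by (simp add: field_simps)
    finally have K3: "3 < K" using two by simp
    show False
    proof (cases "p \<le> 2")
      case False
      have "b\<^sup>2 \<le> x powr p" if "1 \<le> b" "b \<le> x" for b x :: real
      proof -
        have "b\<^sup>2 \<le> x\<^sup>2" using that by (intro power_mono) auto
        also have "\<dots> = x powr 2" using that by (simp add: powr_numeral)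
        also have "\<dots> \<le> x powr p" using that False by (intro powr_mono) auto
        finally show ?thesis .
      qed
      from this[of 3 K] this[of 2 "K - 1"] have "9 \<le> K powr p" "4 \<le> (K - 1) powr p"
        using K3 by auto
      then have "2 / K powr p \<le> 2 / 9" "2 / (K - 1) powr p \<le> 2 / 4"
        using frac_le[of 2 2 9 "K powr p"] frac_le[of 2 2 4 "(K - 1) powr p"] by simp_all
      then show False using eq by simp
    next
      case True
      define v where "v = d powr p"
      have v: "0 < v" unfolding v_def using d0 by simp
      have Kd: "K - 1 = K * d" unfolding d_def using K1 by (simp add: field_simps)
      have Kdp: "(K - 1) powr p = K powr p * v"
        unfolding Kd v_def by (rule powr_mult)
      have Kpos: "0 < K powr p" using K1 by simp
      have Kp: "K powr p * v = 2 * (1 + v)"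
      proof -
        have "K powr p * v * (2 / K powr p + 2 / (K powr p * v)) = 2 * v + 2"
          using v Kpos by (simp add: distrib_left)
        then show ?thesis using eq unfolding Kdp by simp
      qed
      have a: "0 < a" "a \<le> 2" unfolding a_def using p powr_mono[of "1 / p" 1 "2::real"] by auto
      have "(1 / K) powr p = v / (2 * (1 + v))"
        unfolding Kp[symmetric] using v K1 by (simp add: powr_divide)
      then have Ap: "1 - (1 / K) powr p = (2 + v) / (2 * (1 + v))" using v by (simp add: field_simps)
      have A1: "A \<le> 1" unfolding A_def Ap using p v by (intro powr_le1) (auto simp: field_simps)
      have A0: "0 < A" unfolding A_def Ap using v by simp
      have "(K - 1) powr p = 2 * (1 + v)" unfolding Kdp Kp ..
      moreover have "K - 1 = ((K - 1) powr p) powr (1 / p)" using K1 p by (simp add: powr_powr)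
      ultimately have "K - 1 = (2 * (1 + v)) powr (1 / p)" by simp
      then have "A * (K - 1) = ((2 + v) / (2 * (1 + v)) * (2 * (1 + v))) powr (1 / p)"
        unfolding A_def Ap using v by (simp only: powr_mult)
      also have "(2 + v) / (2 * (1 + v)) * (2 * (1 + v)) = 2 * (1 + v / 2)" using v by simp
      also have "(2 * (1 + v / 2)) powr (1 / p) = a * (1 + v / 2) powr (1 / p)"
        unfolding a_def by (rule powr_mult)
      also have "\<dots> \<le> a * (1 + 1 / p * (1 + v / 2 - 1))"
        using a v p by (intro mult_left_mono powr_bernoulli) auto
      finally have AK: "A * (K - 1) \<le> a * (1 + v / (2 * p))" by (simp add: mult.commute)
      have "k * A < K * A" using less A0 by simp
      also have "K * A = A * (K - 1) + A" by (simp add: algebra_simps)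
      finally have "a + a / 2 * (A + d) < a * (1 + v / (2 * p)) + A" using ineq AK by linarith
      moreover have "a / 2 * (A + d) = a / 2 * d + A - A * (1 - a / 2)" by (simp add: algebra_simps)
      ultimately have "a + a / 2 * d < a * (1 + v / (2 * p)) + A * (1 - a / 2)" by linarith
      also have "A * (1 - a / 2) \<le> 1 * (1 - a / 2)" using A1 a by (intro mult_right_mono) auto
      finally have "a + a / 2 * d < a * (1 + v / (2 * p)) + (1 - a / 2)" by simp
      moreover have "2 * (x - y) < 2 - a" if "x < y + (1 - a / 2)" for x y
        using that by argo
      ultimately have "2 * ((a + a / 2 * d) - a * (1 + v / (2 * p))) < 2 - a" by blast
      also have "2 * ((a + a / 2 * d) - a * (1 + v / (2 * p))) = (d - v / p) * a"
        by (simp add: algebra_simps)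
      finally have "(d - v / p) * a < 2 - a" .
      then have "d - v / p < (2 - a) / a" using a by (simp only: pos_less_divide_eq)
      then have "d - v / p < 2 / a - 1" using a by (simp add: diff_divide_distrib)
      moreover have "2 / 3 \<le> d" unfolding d_def using K3 by (simp add: field_simps)
      ultimately show False using tangent_gap[OF p True _ d0(2)] unfolding a_def v_def by simp
    qed
  qed
qed

lemma kappa_gt_3:
  assumes p: "1 \<le> p" "p \<le> 1.6"
  shows "3 < kappa p"
proof (cases "p = 1")
  case True
  then show ?thesis by (simp add: kappa_def)
next
  case False
  then have p1: "1 < p" using p by simp
  define K where "K = kappa p"
  have K1: "1 < K" and eq: "2 / K powr p + 2 / (K - 1) powr p = 1"
    unfolding K_def by (rule kappa_equation[OF p1])+
  \<comment> \<open>The value 1.6 is \<open>8 / 5\<close>, so the two powers can be estimated in integers.\<close>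
  have root: "x powr (8 / 5) < b" if "x ^ 8 < b ^ 5" "0 < x" "0 < b" for x b :: real
  proof -
    have "(x powr (8 / 5)) ^ 5 = x ^ 8"
      using that by (simp add: powr_power powr_numeral)
    with that have "(x powr (8 / 5)) ^ 5 < b ^ 5" by simp
    then show ?thesis by (rule power_less_imp_less_base) (use that in simp)
  qed
  show ?thesis
  proof (rule ccontr)
    assume "\<not> ?thesis"
    then have K3: "K \<le> 3" unfolding K_def by simp
    have "K powr p \<le> 3 powr p" using K1 K3 p by (intro powr_mono2) auto
    also have "\<dots> \<le> 3 powr (8 / 5)" using p by (intro powr_mono) auto
    also have "\<dots> < 5.8" by (rule root) (simp_all add: power_divide)
    finally have 1: "K powr p < 5.8" .
    have "(K - 1) powr p \<le> 2 powr p" using K1 K3 p by (intro powr_mono2) auto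
    also have "\<dots> \<le> 2 powr (8 / 5)" using p by (intro powr_mono) auto
    also have "\<dots> < 3.032" by (rule root) (simp_all add: power_divide)
    finally have 2: "(K - 1) powr p < 3.032" .
    have "2 / 5.8 < 2 / K powr p" using 1 K1 by (intro divide_strict_left_mono) auto
    moreover have "2 / 3.032 < 2 / (K - 1) powr p" using 2 K1 by (intro divide_strict_left_mono) auto
    ultimately show False using eq by simp
  qed
qed

lemma kappa_le_k0:
  assumes "1 \<le> p" shows "ereal (kappa p) \<le> k0 (lp p) (lp_norm p)"
  unfolding k0_def using kappa_le_lipschitz_constant[OF assms] by (auto intro!: Inf_greatest)

theorem theorem2p2:
  "(\<forall>p::real. 1 \<le> p \<longrightarrow> ereal (kappa p) \<le> k0 (lp p) (lp_norm p)) \<and>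
   (\<forall>p::real. 1 \<le> p \<and> p \<le> 1.6 \<longrightarrow> 3 < kappa p) \<and>
   ereal (3 + sqrt 5) \<le> k0 (lp 1) (lp_norm 1)"
proof (intro conjI allI impI)
  show "ereal (kappa p) \<le> k0 (lp p) (lp_norm p)" if "1 \<le> p" for p
    using that by (rule kappa_le_k0)
  show "3 < kappa p" if "1 \<le> p \<and> p \<le> 1.6" for p
    using that kappa_gt_3 by blast
  show "ereal (3 + sqrt 5) \<le> k0 (lp 1) (lp_norm 1)"
    using kappa_le_k0[of 1] by (simp add: kappa_def)
qed

end
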